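(* Consider a complete homogeneous network (with all link capacities equal to $1$) with node arrival rates $\lambda_u\ge 0$, $u\in V$, under the Selfish discipline. Then the process $X(t)$ is stable if $\lambda_u<1$ for all nodes $u\in V$. If, in addition, the network is symmetric, i.e. $\lambda_u=\lambda$ for all nodes $u\in V$, then it is stable if and only if $\lambda<1$.
   Context: Network model. $V$ is a finite set of $N\ge2$ nodes. The network is complete homogeneous: its links are all ordered pairs $(u,v)$ with $u\ne v$, and every link has capacity $1$. At each node $u$ new packets are created (arrive exogenously) according to a Poisson process of rate $\lambda_u\ge0$; $u$ is the source (origin) of these packets. For each link $(u,v)$ there is a Poisson process of rate $1$ of communication epochs; at each such epoch node $u$ may instantly transmit a copy of one packet to node $v$ (keeping its own copy). All these Poisson processes are mutually independent. A packet leaves the network as soon as it is available at all nodes. A packet is useful on link $(u,v)$ at a given time if it is available at $u$ but not at $v$ (it need not have source $u$). Selfish discipline: at each communication epoch of link $(u,v)$, the oldest packet among those currently useful on $(u,v)$ that originated at $u$ is transmitted. If no useful packet originated at $u$ exists, another useful packet is transmitted, chosen according to an arbitrary fixed well-defined rule depending on the current state (for example the oldest, the youngest, or a uniformly random one); if there is no useful packet at all, nothing happens. State and stability. The packets present are labelled $1,\dots,k$ in order of exogenous arrival (1 is the oldest), labels being decremented when an older packet leaves. $X(t)=(x_{uv}(t))_{(u,v)}$, where $x_{uv}(t)$ is the set of (labels of) present packets with source $u$ which are not available at $v$ at time $t$. $X(\cdot)$ is a continuous-time Markov chain on the countable set of states reachable from the empty state; it is called stable if it is positive recurrent (equivalently,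 has a stationary distribution). *)

theory Defs
  imports "HOL-Probability.Probability"
begin

section \<open>Continuous-time Markov chains given by their transition rates\<close>

text \<open>
  For \<open>y \<noteq> x\<close>, \<open>q x y\<close> is the transition rate from \<open>x\<close> to \<open>y\<close>. Diagonal values are never used.
  The chain started in \<open>x\<close> is built from its jump chain and holding times: the path space consists of
  the sequences of pairs (state after the \<open>n\<close>-th jump, holding time in that state). A state with
  exit rate 0 is absorbing; it is held for an infinite time and counts as positive recurrent.
\<close>

definition exit_rate :: "('a \<Rightarrow> 'a \<Rightarrow> real) \<Rightarrow> 'a \<Rightarrow> real" where
  "exit_rate q x = (\<Sum>\<^sub>\<infinity>y\<in>-{x}. q x y)"

definition jump_pmf :: "('a \<Rightarrow> 'a \<Rightarrow> real) \<Rightarrow> 'a \<Rightarrow> 'a pmf" where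
  "jump_pmf q x =
     (if exit_rate q x \<le> 0 then return_pmf x
      else embed_pmf (\<lambda>y. if y = x then 0 else q x y / exit_rate q x))"

definition holding_measure :: "('a \<Rightarrow> 'a \<Rightarrow> real) \<Rightarrow> 'a \<Rightarrow> ennreal measure" where
  "holding_measure q x =
     (if exit_rate q x \<le> 0 then return borel \<infinity>
      else distr (density lborel (\<lambda>t. ennreal (exponential_density (exit_rate q x) t))) borel ennreal)"

abbreviation jump_space :: "('a \<times> ennreal) measure" where
  "jump_space \<equiv> count_space UNIV \<Otimes>\<^sub>M borel"

definition step_measure :: "('a \<Rightarrow> 'a \<Rightarrow> real) \<Rightarrow> 'a pmf \<Rightarrow> ('a \<times> ennreal) measure" where
  "step_measure q p =
     measure_pmf p \<bind> (\<lambda>y. distr (holding_measure q y) jump_space (\<lambda>s. (y, s)))"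

definition path_kernel ::
  "('a \<Rightarrow> 'a \<Rightarrow> real) \<Rightarrow> 'a \<Rightarrow> nat \<Rightarrow> (nat \<Rightarrow> 'a \<times> ennreal) \<Rightarrow> ('a \<times> ennreal) measure" where
  "path_kernel q x n \<omega> =
     step_measure q (case n of 0 \<Rightarrow> return_pmf x | Suc m \<Rightarrow> jump_pmf q (fst (\<omega> m)))"

definition path_measure :: "('a \<Rightarrow> 'a \<Rightarrow> real) \<Rightarrow> 'a \<Rightarrow> (nat \<Rightarrow> 'a \<times> ennreal) measure" where
  "path_measure q x =
     projective_family.lim UNIV (Ionescu_Tulcea.CI (path_kernel q x) (\<lambda>_. jump_space)) (\<lambda>_. jump_space)"

definition jump_time :: "(nat \<Rightarrow> 'a \<times> ennreal) \<Rightarrow> nat \<Rightarrow> ennreal" where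
  "jump_time \<omega> n = (\<Sum>i<n. snd (\<omega> i))"

text \<open>The process \<open>X(t)\<close>; the value \<open>None\<close> is taken from the explosion time on.\<close>

definition process :: "(nat \<Rightarrow> 'a \<times> ennreal) \<Rightarrow> ennreal \<Rightarrow> 'a option" where
  "process \<omega> t =
     (if \<exists>n. t < jump_time \<omega> (Suc n)
      then Some (fst (\<omega> (LEAST n. t < jump_time \<omega> (Suc n)))) else None)"

definition return_time :: "'a \<Rightarrow> (nat \<Rightarrow> 'a \<times> ennreal) \<Rightarrow> ennreal" where
  "return_time x \<omega> = Inf {t. jump_time \<omega> 1 \<le> t \<and> process \<omega> t = Some x}"

definition positive_recurrent_state :: "('a \<Rightarrow> 'a \<Rightarrow> real) \<Rightarrow> 'a \<Rightarrow> bool" where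
  "positive_recurrent_state q x \<longleftrightarrow>
     exit_rate q x \<le> 0 \<or> (\<integral>\<^sup>+\<omega>. return_time x \<omega> \<partial>path_measure q x) < \<infinity>"

definition reachable_from :: "('a \<Rightarrow> 'a \<Rightarrow> real) \<Rightarrow> 'a \<Rightarrow> 'a set" where
  "reachable_from q x = {y. (x, y) \<in> {(a, b). a \<noteq> b \<and> q a b > 0}\<^sup>*}"

definition positive_recurrent_on :: "('a \<Rightarrow> 'a \<Rightarrow> real) \<Rightarrow> 'a set \<Rightarrow> bool" where
  "positive_recurrent_on q S \<longleftrightarrow> (\<forall>x\<in>S. positive_recurrent_state q x)"

text \<open>The kernels satisfy the requirements of the Ionescu-Tulcea theorem for every \<open>q\<close>,
  so \<^const>\<open>path_measure\<close> is always the measure given by that theorem.\<close>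

lemma prob_space_holding: "prob_space (holding_measure q x)"
  unfolding holding_measure_def
  by (auto intro!: prob_space_return prob_space.prob_space_distr prob_space_exponential_density)

lemma step_kernel_measurable:
  "(\<lambda>y. distr (holding_measure q y) jump_space (\<lambda>s. (y, s)))
     \<in> measurable (count_space UNIV) (subprob_algebra jump_space)"
proof (rule measurable_count_space_eq1[THEN iffD2], safe)
  fix y
  have s: "sets (holding_measure q y) = sets borel"
    by (simp add: holding_measure_def)
  interpret prob_space "holding_measure q y" by (rule prob_space_holding)
  have "(\<lambda>s. (y, s)) \<in> measurable (holding_measure q y) jump_space"
    by (subst measurable_cong_sets[OF s refl]) measurable
  then interpret P: prob_space "distr (holding_measure q y) jump_space (\<lambda>s. (y, s))"
    by (rule prob_space_distr)
  show "distr (holding_measure q y) jump_space (\<lambda>s. (y, s)) \<in> space (subprob_algebra jump_space)"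
    by (simp add: space_subprob_algebra P.subprob_space_axioms)
qed

lemma step_measure_props:
  "prob_space (step_measure q p)" "sets (step_measure q p) = sets jump_space"
proof -
  have k: "(\<lambda>y. distr (holding_measure q y) jump_space (\<lambda>s. (y, s)))
     \<in> measurable (measure_pmf p) (subprob_algebra jump_space)"
    unfolding measurable_cong_sets[OF sets_measure_pmf_count_space refl]
    by (rule step_kernel_measurable)
  have "prob_space (distr (holding_measure q y) jump_space (\<lambda>s. (y, s)))" for y
  proof -
    have s: "sets (holding_measure q y) = sets borel"
      by (simp add: holding_measure_def)
    interpret prob_space "holding_measure q y" by (rule prob_space_holding)
    show ?thesis
      by (rule prob_space_distr, subst measurable_cong_sets[OF s refl]) measurable
  qed
  then show "prob_space (step_measure q p)"
    unfolding step_measure_def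
    by (intro measure_pmf.prob_space_bind[OF _ k]) auto
  show "sets (step_measure q p) = sets jump_space"
    unfolding step_measure_def
    by (subst sets_bind[where N = jump_space]) auto
qed

lemma Ionescu_Tulcea_path_kernel: "Ionescu_Tulcea (path_kernel q x) (\<lambda>_. jump_space)"
proof (rule Ionescu_Tulcea.intro)
  have m: "step_measure q p \<in> space (subprob_algebra jump_space)" for p
    using step_measure_props[of q p]
    by (simp add: space_subprob_algebra prob_space_imp_subprob_space)
  fix i
  show "path_kernel q x i \<in> measurable (PiM {0..<i} (\<lambda>_. jump_space)) (subprob_algebra jump_space)"
  proof (cases i)
    case 0
    then show ?thesis using m by (simp add: path_kernel_def[abs_def])
  next
    case (Suc n)
    have 1: "(\<lambda>z. step_measure q (jump_pmf q z)) \<in> measurable (count_space UNIV) (subprob_algebra jump_space)"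
      using m by simp
    have 2: "(\<lambda>\<omega>. fst (\<omega> n)) \<in> measurable (PiM {0..<i} (\<lambda>_. jump_space)) (count_space UNIV)"
    proof -
      have [measurable]: "n \<in> {0..<i}" using Suc by simp
      show ?thesis by measurable
    qed
    show ?thesis
      using measurable_compose[OF 2 1] by (simp only: path_kernel_def[abs_def] Suc nat.case)
  qed
next
  show "prob_space (path_kernel q x i \<omega>)" for i \<omega>
    unfolding path_kernel_def by (rule step_measure_props)
qed


section \<open>The network under the Selfish discipline\<close>

text \<open>
  The nodes are the elements of the finite type \<open>'v\<close>, the links the pairs \<open>(u, v)\<close> with \<open>u \<noteq> v\<close>.
  In a state \<open>x\<close>, \<open>x u v\<close> is the set of labels of the present packets with source \<open>u\<close> that are not
  available at \<open>v\<close>; so \<open>x u u = {}\<close> in all reachable states, and the present packets, labelled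
  \<open>1, ..., k\<close> from oldest to youngest, are those occurring in some \<open>x u v\<close>.
\<close>

type_synonym 'v net_state = "'v \<Rightarrow> 'v \<Rightarrow> nat set"

definition empty_state :: "'v net_state" where
  "empty_state = (\<lambda>u v. {})"

definition originated :: "'v net_state \<Rightarrow> 'v \<Rightarrow> nat set" where
  "originated x u = (\<Union>v. x u v)"

definition packets :: "'v net_state \<Rightarrow> nat set" where
  "packets x = (\<Union>u. originated x u)"

definition available :: "'v net_state \<Rightarrow> 'v \<Rightarrow> nat set" where
  "available x v = {p \<in> packets x. \<forall>u. p \<notin> x u v}"

definition useful :: "'v net_state \<Rightarrow> 'v \<Rightarrow> 'v \<Rightarrow> nat set" where
  "useful x u v = available x u - available x v"

definition arrive :: "'v \<Rightarrow> 'v net_state \<Rightarrow> 'v net_state" where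
  "arrive u x =
     (\<lambda>w v. if w = u \<and> v \<noteq> u then insert (card (packets x) + 1) (x w v) else x w v)"

text \<open>After packet \<open>p\<close> has left, all younger packets move up by one label.\<close>

definition relabel :: "nat \<Rightarrow> 'v net_state \<Rightarrow> 'v net_state" where
  "relabel p x = (\<lambda>u v. (\<lambda>i. if i > p then i - 1 else i) ` x u v)"

definition deliver :: "nat \<Rightarrow> 'v \<Rightarrow> 'v net_state \<Rightarrow> 'v net_state" where
  "deliver p v x =
     (let y = (\<lambda>u w. if w = v then x u w - {p} else x u w)
      in if p \<in> packets y then y else relabel p y)"

text \<open>
  \<open>rule x u v\<close> is the (possibly degenerate) distribution of the packet transmitted on \<open>(u, v)\<close> in
  state \<open>x\<close> when there are useful packets on \<open>(u, v)\<close>, but none of them originated at \<open>u\<close>.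
\<close>

type_synonym 'v fallback_rule = "'v net_state \<Rightarrow> 'v \<Rightarrow> 'v \<Rightarrow> nat pmf"

definition selfish_transmit :: "'v fallback_rule \<Rightarrow> 'v \<Rightarrow> 'v \<Rightarrow> 'v net_state \<Rightarrow> 'v net_state pmf" where
  "selfish_transmit rule u v x =
     (if useful x u v = {} then return_pmf x
      else if useful x u v \<inter> originated x u \<noteq> {}
        then return_pmf (deliver (Min (useful x u v \<inter> originated x u)) v x)
      else map_pmf (\<lambda>p. deliver p v x) (rule x u v))"

text \<open>Arrivals at \<open>u\<close> occur at rate \<open>arr u\<close>, communication epochs of each link at rate 1.\<close>

definition selfish_rate ::
  "('v::finite \<Rightarrow> real) \<Rightarrow> 'v fallback_rule \<Rightarrow> 'v net_state \<Rightarrow> 'v net_state \<Rightarrow> real" where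
  "selfish_rate arr rule x y =
     (\<Sum>u\<in>UNIV. if y = arrive u x then arr u else 0) +
     (\<Sum>(u, v)\<in>{(u, v). u \<noteq> v}. pmf (selfish_transmit rule u v x) y)"

definition selfish_states :: "('v::finite \<Rightarrow> real) \<Rightarrow> 'v fallback_rule \<Rightarrow> 'v net_state set" where
  "selfish_states arr rule = reachable_from (selfish_rate arr rule) empty_state"

definition valid_fallback_rule :: "('v::finite \<Rightarrow> real) \<Rightarrow> 'v fallback_rule \<Rightarrow> bool" where
  "valid_fallback_rule arr rule \<longleftrightarrow>
     (\<forall>x\<in>selfish_states arr rule. \<forall>u v. u \<noteq> v \<longrightarrow>
        useful x u v \<noteq> {} \<longrightarrow> useful x u v \<inter> originated x u = {} \<longrightarrow>
        set_pmf (rule x u v) \<subseteq> useful x u v)"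

definition selfish_stable :: "('v::finite \<Rightarrow> real) \<Rightarrow> 'v fallback_rule \<Rightarrow> bool" where
  "selfish_stable arr rule \<longleftrightarrow>
     positive_recurrent_on (selfish_rate arr rule) (selfish_states arr rule)"

end

theory Submission
  imports Defs
begin

text \<open>
  Exit rates are bounded away from 0 and infinity, so a state is positive recurrent iff the jump chain
  returns to it after a finite mean number of jumps, i.e. iff the probabilities of not having returned
  within \<open>n\<close> jumps are summable. If all arrival rates are below 1, the sum of the squared queue lengths
  \<open>card (x u v)\<close> is a Lyapunov function. If all are at least 1, the number of missing deliveries is a
  submartingale with bounded jumps (arrivals create work at least at the total link capacity), and a
  submartingale that leaves 0 cannot return to it in finite mean time.
\<close>

section \<open>Integrals over the path space\<close>

text \<open>The return time is an infimum over a continuum of times. Comparing it pathwise with the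
  holding times up to the first return of the jump chain leaves a series of integrals over finitely
  many coordinates, which \<open>taboo\<close> evaluates as iterated means. The fallback rule is
  arbitrary, so a Lyapunov function may rely only on what every rule guarantees: an epoch of link
  \<open>(u, v)\<close> serves \<open>x u v\<close> if this set is nonempty, and otherwise makes
  some other delivery or none. A linear function fails: an empty queue may get no benefit from its
  link while arrivals at its source go on, so the total may grow in the mean although another queue
  is long. Squares weight the drift of each queue by its length, which leaves only a bounded
  contribution of the empty ones. At arrival rate exactly 1 the number of missing deliveries may
  have drift 0 in some states, so escape to infinity cannot be the argument; what is excluded is a
  finite mean return time, and this also covers a chain that does return almost surely.\<close>

lemma sets_holding_measure [simp, measurable_cong]: "sets (holding_measure q y) = sets borel"
  by (simp add: holding_measure_def)

lemma nn_integral_step_measure: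
  assumes g[measurable]: "g \<in> borel_measurable jump_space"
  shows "(\<integral>\<^sup>+z. g z \<partial>step_measure q p) = (\<integral>\<^sup>+y. \<integral>\<^sup>+s. g (y, s) \<partial>holding_measure q y \<partial>measure_pmf p)"
proof -
  have k: "(\<lambda>y. distr (holding_measure q y) jump_space (\<lambda>s. (y, s)))
     \<in> measurable (measure_pmf p) (subprob_algebra jump_space)"
    unfolding measurable_cong_sets[OF sets_measure_pmf_count_space refl]
    by (rule step_kernel_measurable)
  show ?thesis
    unfolding step_measure_def
    by (subst nn_integral_bind[OF g k]) (auto intro!: nn_integral_cong nn_integral_distr)
qed

text \<open>The marginal of the projective limit on \<open>{0..<n}\<close> is
  \<open>CI {0..<n}\<close>. As \<open>up_to {0..<n} = n\<close>, this is \<open>C 0 n\<close>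
  pushed through a restriction that acts as the identity on its space.\<close>

lemma nn_integral_path_measure_restrict:
  assumes f[measurable]: "f \<in> borel_measurable (PiM {0..<n} (\<lambda>_. jump_space))"
  shows "(\<integral>\<^sup>+\<omega>. f (restrict \<omega> {0..<n}) \<partial>path_measure q x) =
    (\<integral>\<^sup>+\<omega>. f \<omega> \<partial>Ionescu_Tulcea.C (path_kernel q x) (\<lambda>_. jump_space) 0 n (\<lambda>_. undefined))"
proof -
  interpret IT: Ionescu_Tulcea "path_kernel q x" "\<lambda>_. jump_space"
    by (rule Ionescu_Tulcea_path_kernel)
  have u: "IT.up_to {0..<n} = n"
    using IT.up_to_iff_Ico[of "{0..<n}" n] IT.up_to[of "{0..<n}"] by (auto simp: le_antisym)
  have s: "sets (path_measure q x) = sets (PiM UNIV (\<lambda>_. jump_space))"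
    by (simp add: path_measure_def)
  have [measurable]: "(\<lambda>\<omega>. restrict \<omega> {0..<n}) \<in> measurable (path_measure q x) (PiM {0..<n} (\<lambda>_. jump_space))"
    unfolding measurable_cong_sets[OF s refl] by (intro measurable_restrict_subset) auto
  have m0: "(\<lambda>\<omega>. restrict \<omega> {0..<n}) \<in> measurable (IT.C 0 n (\<lambda>_. undefined)) (PiM {0..<n} (\<lambda>_. jump_space))"
    by (subst measurable_cong_sets[OF IT.sets_C refl]) (auto simp: space_PiM intro!: measurable_restrict_subset)
  have "(\<integral>\<^sup>+\<omega>. f (restrict \<omega> {0..<n}) \<partial>path_measure q x) =
     (\<integral>\<^sup>+\<omega>. f \<omega> \<partial>distr (path_measure q x) (PiM {0..<n} (\<lambda>_. jump_space)) (\<lambda>\<omega>. restrict \<omega> {0..<n}))"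
    by (subst nn_integral_distr) auto
  also have "\<dots> = (\<integral>\<^sup>+\<omega>. f \<omega> \<partial>IT.CI {0..<n})"
    unfolding path_measure_def by (subst IT.distr_lim) auto
  also have "\<dots> = (\<integral>\<^sup>+\<omega>. f (restrict \<omega> {0..<n}) \<partial>IT.C 0 n (\<lambda>_. undefined))"
    unfolding IT.CI_def u by (rule nn_integral_distr[OF m0]) simp
  also have "\<dots> = (\<integral>\<^sup>+\<omega>. f \<omega> \<partial>IT.C 0 n (\<lambda>_. undefined))"
    by (intro nn_integral_cong) (auto simp: IT.space_C space_PiM simp del: restrict_apply)
  finally show ?thesis .
qed

lemma sets_path_measure [simp, measurable_cong]:
  "sets (path_measure q x) = sets (PiM UNIV (\<lambda>_. jump_space))"
proof -
  interpret IT: Ionescu_Tulcea "path_kernel q x" "\<lambda>_. jump_space"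
    by (rule Ionescu_Tulcea_path_kernel)
  show ?thesis by (simp add: path_measure_def)
qed

lemma prob_space_path_measure: "prob_space (path_measure q x)"
proof (rule prob_spaceI)
  interpret IT: Ionescu_Tulcea "path_kernel q x" "\<lambda>_. jump_space"
    by (rule Ionescu_Tulcea_path_kernel)
  have "prob_space (IT.C 0 0 (\<lambda>_. undefined))"
    by (rule IT.prob_space_C) (simp add: space_PiM)
  from prob_space.emeasure_space_1[OF this] show "emeasure (path_measure q x) (space (path_measure q x)) = 1"
    using nn_integral_path_measure_restrict[of "\<lambda>_. 1" 0 q x] by simp
qed

text \<open>This says that \<open>path_kernel q x n\<close> is the conditional law of coordinate
  \<open>n\<close> given the earlier ones. It is inherited from \<open>C 0 (Suc n)\<close>, which is
  \<open>C 0 n\<close> bound to the one-step extension \<open>eP n\<close>.\<close>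

lemma nn_integral_path_measure_step:
  assumes F[measurable]: "F \<in> borel_measurable (PiM {0..<n} (\<lambda>_. jump_space))"
    and g[measurable]: "g \<in> borel_measurable jump_space"
  shows "(\<integral>\<^sup>+\<omega>. F (restrict \<omega> {0..<n}) * g (\<omega> n) \<partial>path_measure q x) =
    (\<integral>\<^sup>+\<omega>. F (restrict \<omega> {0..<n}) * (\<integral>\<^sup>+z. g z \<partial>path_kernel q x n (restrict \<omega> {0..<n})) \<partial>path_measure q x)"
proof -
  interpret IT: Ionescu_Tulcea "path_kernel q x" "\<lambda>_. jump_space"
    by (rule Ionescu_Tulcea_path_kernel)
  have P[measurable]: "path_kernel q x n \<in> measurable (PiM {0..<n} (\<lambda>_. jump_space)) (subprob_algebra jump_space)"
    by (rule IT.P)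
  let ?G = "\<lambda>\<omega>. F (restrict \<omega> {0..<n}) * g (\<omega> n)"
  have r[measurable]: "(\<lambda>\<omega>. restrict \<omega> {0..<n}) \<in> measurable (PiM {0..<Suc n} (\<lambda>_. jump_space)) (PiM {0..<n} (\<lambda>_. jump_space))"
    by (intro measurable_restrict_subset) auto
  have [measurable]: "?G \<in> borel_measurable (PiM {0..<Suc n} (\<lambda>_. jump_space))"
  proof -
    have [measurable]: "n \<in> {0..<Suc n}" by simp
    show ?thesis by measurable
  qed
  have u: "(\<lambda>_. undefined) \<in> space (PiM {0..<0::nat} (\<lambda>_. jump_space))" by (simp add: space_PiM)
  have "(\<integral>\<^sup>+\<omega>. ?G \<omega> \<partial>path_measure q x) = (\<integral>\<^sup>+\<omega>. ?G (restrict \<omega> {0..<Suc n}) \<partial>path_measure q x)"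
    by (intro nn_integral_cong) (auto simp: restrict_restrict Int_absorb1)
  also have "\<dots> = (\<integral>\<^sup>+\<omega>. ?G \<omega> \<partial>IT.C 0 (Suc n) (\<lambda>_. undefined))"
    by (subst nn_integral_path_measure_restrict[where f="?G"]) (auto simp del: IT.C.simps)
  also have "\<dots> = (\<integral>\<^sup>+\<omega>. \<integral>\<^sup>+\<omega>'. ?G \<omega>' \<partial>IT.eP n \<omega> \<partial>IT.C 0 n (\<lambda>_. undefined))"
    using IT.sets_C[OF u, of n]
    by (simp, subst nn_integral_bind[where B="PiM {0..<Suc n} (\<lambda>_. jump_space)"])
       (auto simp: measurable_cong_sets[OF IT.sets_C[OF u] refl])
  also have "\<dots> = (\<integral>\<^sup>+\<omega>. F \<omega> * (\<integral>\<^sup>+z. g z \<partial>path_kernel q x n \<omega>) \<partial>IT.C 0 n (\<lambda>_. undefined))"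
  proof (rule nn_integral_cong)
    fix \<omega> assume "\<omega> \<in> space (IT.C 0 n (\<lambda>_. undefined))"
    then have \<omega>: "\<omega> \<in> space (PiM {0..<n} (\<lambda>_. jump_space))" using u by (simp add: IT.space_C)
    \<comment> \<open>Points of the product space are \<open>undefined\<close> outside
      \<open>{0..<n}\<close>, so overwriting coordinate \<open>n\<close> and restricting gives back
      \<open>\<omega>\<close>.\<close>
    then have e: "restrict (fun_upd \<omega> n z) {0..<n} = \<omega>" for z
      by (auto simp: space_PiM PiE_def extensional_def fun_eq_iff)
    have "(\<integral>\<^sup>+\<omega>'. ?G \<omega>' \<partial>IT.eP n \<omega>) = (\<integral>\<^sup>+z. F \<omega> * g z \<partial>path_kernel q x n \<omega>)"
      by (subst IT.nn_integral_eP[OF \<omega>]) (auto simp: e)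
    also have "\<dots> = F \<omega> * (\<integral>\<^sup>+z. g z \<partial>path_kernel q x n \<omega>)"
      by (rule nn_integral_cmult) (simp add: measurable_cong_sets[OF IT.sets_P[OF \<omega>] refl])
    finally show "(\<integral>\<^sup>+\<omega>'. ?G \<omega>' \<partial>IT.eP n \<omega>) = F \<omega> * (\<integral>\<^sup>+z. g z \<partial>path_kernel q x n \<omega>)" .
  qed
  also have "\<dots> = (\<integral>\<^sup>+\<omega>. F (restrict \<omega> {0..<n}) * (\<integral>\<^sup>+z. g z \<partial>path_kernel q x n (restrict \<omega> {0..<n})) \<partial>path_measure q x)"
    by (subst nn_integral_path_measure_restrict[symmetric]) auto
  finally show ?thesis .
qed

section \<open>Means over paths that have not yet returned\<close>

text \<open>\<open>taboo q x n f\<close> is the mean of \<open>f\<close> at the \<open>n\<close>-th state of the jump chain started in \<open>x\<close>, restricted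
  to the paths that avoid \<open>x\<close> at the times \<open>1, ..., n\<close>.\<close>

primrec taboo :: "('a \<Rightarrow> 'a \<Rightarrow> real) \<Rightarrow> 'a \<Rightarrow> nat \<Rightarrow> ('a \<Rightarrow> ennreal) \<Rightarrow> ennreal" where
  "taboo q x 0 f = f x"
| "taboo q x (Suc n) f = taboo q x n (\<lambda>z. \<integral>\<^sup>+y. (if y = x then 0 else f y) \<partial>measure_pmf (jump_pmf q z))"

text \<open>Index 0 is left out because the path starts in \<open>x\<close>; thus
  \<open>unreturned x 0\<close> is the whole space.\<close>

definition unreturned :: "'a \<Rightarrow> nat \<Rightarrow> (nat \<Rightarrow> 'a \<times> ennreal) set" where
  "unreturned x n = {\<omega>. \<forall>i\<in>{1..n}. fst (\<omega> i) \<noteq> x}"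

text \<open>The index set is kept general because the event is used both on the full product and on
  \<open>{0..<Suc n}\<close>, where the one-step formula wants its factor \<open>F\<close> to be
  measurable.\<close>

lemma measurable_unreturned:
  assumes "{1..n} \<subseteq> I"
  shows "(indicator (unreturned x n) :: _ \<Rightarrow> ennreal) \<in> borel_measurable (PiM I (\<lambda>_. jump_space))"
proof -
  have "(indicator (unreturned x n) :: _ \<Rightarrow> ennreal) = (\<lambda>\<omega>. \<Prod>i\<in>{1..n}. indicator (-{x}) (fst (\<omega> i)))"
    by (auto simp: unreturned_def fun_eq_iff indicator_def prod_zero_iff)
  also have "\<dots> \<in> borel_measurable (PiM I (\<lambda>_. jump_space))"
  proof (rule borel_measurable_prod_ennreal)
    fix i assume "i \<in> {1..n}"
    then have "i \<in> I" using assms by auto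
    have "(\<lambda>z. indicator (-{x}) (fst z) :: ennreal) \<in> borel_measurable jump_space"
      by (rule measurable_compose[OF measurable_fst]) simp
    then show "(\<lambda>\<omega>. indicator (-{x}) (fst (\<omega> i)) :: ennreal) \<in> borel_measurable (PiM I (\<lambda>_. jump_space))"
      by (rule measurable_compose[OF measurable_component_singleton[OF \<open>i \<in> I\<close>]])
  qed
  finally show ?thesis .
qed

lemmas measurable_unreturned_UNIV [measurable] = measurable_unreturned[OF subset_UNIV]

text \<open>Peeling off the last jump replaces \<open>g\<close> by its mean over one jump with
  arrivals in \<open>x\<close> discarded. The new function ignores the holding time, so averaging it
  over the holding time changes nothing and the induction hypothesis, general in \<open>g\<close>,
  applies.\<close>

lemma nn_integral_taboo:
  assumes g[measurable]: "g \<in> borel_measurable jump_space"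
  shows "(\<integral>\<^sup>+\<omega>. indicator (unreturned x n) \<omega> * g (\<omega> n) \<partial>path_measure q x) =
    taboo q x n (\<lambda>y. \<integral>\<^sup>+s. g (y, s) \<partial>holding_measure q y)"
  using g
proof (induction n arbitrary: g)
  case 0
  note [measurable] = 0
  have "(\<integral>\<^sup>+\<omega>. indicator (unreturned x 0) \<omega> * g (\<omega> 0) \<partial>path_measure q x) =
    (\<integral>\<^sup>+\<omega>. 1 * g (\<omega> 0) \<partial>path_measure q x)"
    by (simp add: unreturned_def)
  also have "\<dots> = (\<integral>\<^sup>+\<omega>. 1 * (\<integral>\<^sup>+z. g z \<partial>path_kernel q x 0 (restrict \<omega> {0..<0})) \<partial>path_measure q x)"
    by (rule nn_integral_path_measure_step) auto
  also have "\<dots> = (\<integral>\<^sup>+\<omega>. (\<integral>\<^sup>+s. g (x, s) \<partial>holding_measure q x) \<partial>path_measure q x)"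
    by (simp add: path_kernel_def nn_integral_step_measure nn_integral_return)
  also have "\<dots> = (\<integral>\<^sup>+s. g (x, s) \<partial>holding_measure q x)"
    by (simp add: prob_space.emeasure_space_1[OF prob_space_path_measure])
  finally show ?case by simp
next
  case (Suc n)
  note [measurable] = Suc.prems
  let ?h = "\<lambda>z. (if fst z = x then 0 else g z)"
  let ?F = "\<lambda>\<omega>. indicator (unreturned x n) \<omega> :: ennreal"
  have m[measurable]: "?F \<in> borel_measurable (PiM {0..<Suc n} (\<lambda>_. jump_space))"
    by (rule measurable_unreturned) auto
  have res: "?F (restrict \<omega> {0..<Suc n}) = ?F \<omega>" for \<omega>
    by (auto simp: unreturned_def indicator_def)
  let ?k = "\<lambda>z. \<integral>\<^sup>+y. (if y = x then 0 else \<integral>\<^sup>+s. g (y, s) \<partial>holding_measure q y) \<partial>measure_pmf (jump_pmf q z)"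
  have k: "(\<integral>\<^sup>+z. ?h z \<partial>path_kernel q x (Suc n) \<omega>) = ?k (fst (\<omega> n))" for \<omega>
    by (auto simp: path_kernel_def nn_integral_step_measure intro!: nn_integral_cong)
  have "(\<integral>\<^sup>+\<omega>. indicator (unreturned x (Suc n)) \<omega> * g (\<omega> (Suc n)) \<partial>path_measure q x) =
    (\<integral>\<^sup>+\<omega>. ?F (restrict \<omega> {0..<Suc n}) * ?h (\<omega> (Suc n)) \<partial>path_measure q x)"
    unfolding res
    by (intro nn_integral_cong) (auto simp: unreturned_def indicator_def atLeastAtMostSuc_conv)
  also have "\<dots> = (\<integral>\<^sup>+\<omega>. ?F (restrict \<omega> {0..<Suc n}) *
      (\<integral>\<^sup>+z. ?h z \<partial>path_kernel q x (Suc n) (restrict \<omega> {0..<Suc n})) \<partial>path_measure q x)"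
    by (rule nn_integral_path_measure_step) auto
  also have "\<dots> = (\<integral>\<^sup>+\<omega>. ?F \<omega> * ?k (fst (\<omega> n)) \<partial>path_measure q x)"
    unfolding res k by simp
  also have "\<dots> = taboo q x n (\<lambda>y. \<integral>\<^sup>+s. ?k y \<partial>holding_measure q y)"
  proof (subst Suc.IH)
    show "(\<lambda>z. ?k (fst z)) \<in> borel_measurable jump_space"
      by (rule measurable_compose[OF measurable_fst]) simp
  qed simp
  also have "(\<lambda>y. \<integral>\<^sup>+s. ?k y \<partial>holding_measure q y) = ?k"
    by (simp add: prob_space.emeasure_space_1[OF prob_space_holding])
  finally show ?case by simp
qed

section \<open>The return time\<close>

lemma nn_integral_holding_measure:
  assumes "exit_rate q y > 0"
  shows "(\<integral>\<^sup>+s. s \<partial>holding_measure q y) = ennreal (1 / exit_rate q y)"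
proof -
  let ?r = "exit_rate q y"
  have "(\<integral>\<^sup>+s. s \<partial>holding_measure q y) = (\<integral>\<^sup>+t. ennreal (exponential_density ?r t) * ennreal t \<partial>lborel)"
    using assms by (simp add: holding_measure_def nn_integral_distr nn_integral_density)
  also have "\<dots> = (\<integral>\<^sup>+t. ennreal (exponential_density ?r t * t ^ 1) \<partial>lborel)"
    using assms by (intro nn_integral_cong) (auto simp: ennreal_mult' exponential_density_nonneg)
  \<comment> \<open>The exponential density is the Erlang density with shape index 0; its first
    moment is taken.\<close>
  also have "\<dots> = ennreal (1 / ?r)"
    using nn_integral_erlang_ith_moment[OF assms, of 0 1] by simp
  finally show ?thesis .
qed

lemma holding_measure_pos: "(\<integral>\<^sup>+s. indicator {0} s \<partial>holding_measure q y) = 0"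
proof (cases "exit_rate q y \<le> 0")
  case True
  then show ?thesis by (simp add: holding_measure_def nn_integral_return)
next
  case False
  have "(\<integral>\<^sup>+s. indicator {0} s \<partial>holding_measure q y) =
     (\<integral>\<^sup>+t. ennreal (exponential_density (exit_rate q y) t) * indicator {0} (ennreal t) \<partial>lborel)"
    using False
    by (simp add: holding_measure_def nn_integral_distr nn_integral_density del: nn_integral_indicator)
  \<comment> \<open>\<open>ennreal\<close> sends every negative real to 0 too, but the density
    vanishes there; only the point 0 remains, where the density equals the rate.\<close>
  also have "\<dots> = (\<integral>\<^sup>+t. ennreal (exit_rate q y) * indicator {0::real} t \<partial>lborel)"
    using False by (intro nn_integral_cong)
      (auto simp: exponential_density_def indicator_def)
  also have "\<dots> = 0" by simp
  finally show ?thesis .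
qed

text \<open>A state held for time 0 is invisible to \<open>process\<close>, so the jump chain could
  return to \<open>x\<close> unnoticed. This null event has to be removed before the return time can
  be bounded from above.\<close>

lemma AE_holding_time_pos: "AE \<omega> in path_measure q x. \<forall>n. snd (\<omega> n) > 0"
proof (subst AE_all_countable, rule allI)
  fix n
  have "(\<integral>\<^sup>+\<omega>. 1 * indicator {z. snd z = 0} (\<omega> n) \<partial>path_measure q x) =
    (\<integral>\<^sup>+\<omega>. 1 * (\<integral>\<^sup>+z. indicator {z. snd z = 0} z \<partial>path_kernel q x n (restrict \<omega> {0..<n})) \<partial>path_measure q x)"
    by (rule nn_integral_path_measure_step) auto
  also have "\<dots> = 0"
  proof -
    have "(\<integral>\<^sup>+z. indicator {z. snd z = 0} z \<partial>path_kernel q x n \<omega>) = 0" for \<omega>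
    proof -
      have "(\<integral>\<^sup>+s. indicator {z. snd z = 0} (y, s) \<partial>holding_measure q y) = 0" for y
        using holding_measure_pos[of q y] by (simp add: indicator_def)
      then show ?thesis
        unfolding path_kernel_def by (subst nn_integral_step_measure) auto
    qed
    then show ?thesis by (simp del: nn_integral_indicator)
  qed
  finally have "(\<integral>\<^sup>+\<omega>. indicator {z. snd z = 0} (\<omega> n) \<partial>path_measure q x) = 0" by simp
  then have "AE \<omega> in path_measure q x. indicator {z. snd z = 0} (\<omega> n) = (0::ennreal)"
    by (subst (asm) nn_integral_0_iff_AE) auto
  then show "AE \<omega> in path_measure q x. snd (\<omega> n) > 0"
    by eventually_elim (auto simp: indicator_def zero_less_iff_neq_zero split: if_splits)
qed

section \<open>The return time as a sum of holding times\<close>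

lemma jump_time_mono: "m \<le> n \<Longrightarrow> jump_time \<omega> m \<le> jump_time \<omega> n"
  unfolding jump_time_def by (intro sum_mono2) auto

text \<open>If the process is in \<open>x\<close> at a time \<open>t\<close> after the first jump,
  the index \<open>n\<close> of the current holding interval is positive and the jump chain is in
  \<open>x\<close> at step \<open>n\<close>. So the series stops before \<open>n\<close>, and those
  holding times have elapsed by \<open>t\<close>. A path that never comes back has the empty
  infimum, which is infinite.\<close>

lemma return_time_ge: "(\<Sum>n. indicator (unreturned x n) \<omega> * snd (\<omega> n)) \<le> return_time x \<omega>"
  unfolding return_time_def
proof (rule Inf_greatest, safe)
  fix t assume t1: "jump_time \<omega> 1 \<le> t" and t: "process \<omega> t = Some x"
  define n where "n = (LEAST n. t < jump_time \<omega> (Suc n))"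
  have ex: "\<exists>n. t < jump_time \<omega> (Suc n)" and x: "fst (\<omega> n) = x"
    using t by (auto simp: process_def n_def split: if_splits)
  have "t < jump_time \<omega> (Suc n)"
    using LeastI_ex[OF ex] by (simp add: n_def)
  with t1 have n: "n > 0" by (cases n) auto
  have "\<not> t < jump_time \<omega> (Suc (n - 1))"
    using n not_less_Least[of "n - 1" "\<lambda>n. t < jump_time \<omega> (Suc n)"] by (simp add: n_def)
  with n have tn: "jump_time \<omega> n \<le> t" by simp
  have "(\<Sum>i. indicator (unreturned x i) \<omega> * snd (\<omega> i)) = (\<Sum>i<n. indicator (unreturned x i) \<omega> * snd (\<omega> i))"
    using n x by (intro suminf_finite) (auto simp: unreturned_def indicator_def)
  also have "\<dots> \<le> jump_time \<omega> n"
    unfolding jump_time_def by (intro sum_mono) (auto simp: indicator_def)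
  finally show "(\<Sum>i. indicator (unreturned x i) \<omega> * snd (\<omega> i)) \<le> t" using tn by simp
qed

text \<open>Let \<open>n\<close> be the first return of the jump chain. As its holding time is
  positive, the process is in \<open>x\<close> exactly at \<open>jump_time \<omega> n\<close>, which
  is the partial sum of the series up to \<open>n\<close>. If this time is infinite, so is the
  series.\<close>

lemma return_time_le:
  assumes ret: "\<omega> \<notin> unreturned x m" and pos: "\<And>n. snd (\<omega> n) > 0"
  shows "return_time x \<omega> \<le> (\<Sum>n. indicator (unreturned x n) \<omega> * snd (\<omega> n))"
proof -
  define n where "n = (LEAST n. 1 \<le> n \<and> fst (\<omega> n) = x)"
  have ex: "\<exists>n. 1 \<le> n \<and> fst (\<omega> n) = x"
    using ret by (auto simp: unreturned_def)
  have n: "1 \<le> n" "fst (\<omega> n) = x"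
    using LeastI_ex[OF ex] by (simp_all add: n_def)
  have less: "\<omega> \<in> unreturned x i" if "i < n" for i
  proof -
    have "\<not> (1 \<le> j \<and> fst (\<omega> j) = x)" if "j \<le> i" for j
      using that \<open>i < n\<close> unfolding n_def by (intro not_less_Least) simp
    then show ?thesis by (auto simp: unreturned_def)
  qed
  have "jump_time \<omega> n = (\<Sum>i<n. indicator (unreturned x i) \<omega> * snd (\<omega> i))"
    unfolding jump_time_def by (intro sum.cong) (auto simp: less)
  also have "\<dots> \<le> (\<Sum>n. indicator (unreturned x n) \<omega> * snd (\<omega> n))"
    by (intro sum_le_suminf) auto
  finally have le: "jump_time \<omega> n \<le> (\<Sum>n. indicator (unreturned x n) \<omega> * snd (\<omega> n))" .
  show ?thesis
  proof (cases "jump_time \<omega> n = \<infinity>")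
    case True
    with le show ?thesis by (simp add: top_unique)
  next
    case False
    then have lt: "jump_time \<omega> n < jump_time \<omega> (Suc n)"
      using ennreal_add_left_cancel_less[of "jump_time \<omega> n" 0 "snd (\<omega> n)"] pos[of n]
      by (simp add: jump_time_def top.not_eq_extremum)
    have "(LEAST k. jump_time \<omega> n < jump_time \<omega> (Suc k)) = n"
    proof (rule Least_equality)
      show "jump_time \<omega> n < jump_time \<omega> (Suc n)" by (rule lt)
      fix k assume "jump_time \<omega> n < jump_time \<omega> (Suc k)"
      then show "n \<le> k"
        using jump_time_mono[of "Suc k" n \<omega>] by (meson leD not_less_eq_eq)
    qed
    then have "process \<omega> (jump_time \<omega> n) = Some x"
      using lt n by (auto simp: process_def)
    then have "return_time x \<omega> \<le> jump_time \<omega> n"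
      unfolding return_time_def using n by (intro Inf_lower) (auto intro: jump_time_mono)
    with le show ?thesis by simp
  qed
qed

lemma nn_integral_unreturned_time:
  "(\<integral>\<^sup>+\<omega>. (\<Sum>n. indicator (unreturned x n) \<omega> * snd (\<omega> n)) \<partial>path_measure q x) =
    (\<Sum>n. taboo q x n (\<lambda>y. \<integral>\<^sup>+s. s \<partial>holding_measure q y))"
proof -
  have "(\<integral>\<^sup>+\<omega>. (\<Sum>n. indicator (unreturned x n) \<omega> * snd (\<omega> n)) \<partial>path_measure q x) =
    (\<Sum>n. \<integral>\<^sup>+\<omega>. indicator (unreturned x n) \<omega> * snd (\<omega> n) \<partial>path_measure q x)"
    by (rule nn_integral_suminf) measurable
  then show ?thesis by (simp add: nn_integral_taboo)
qed

text \<open>\<open>T n\<close> confines the chain at time \<open>n\<close>. A constant family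
  expresses a closed set of states; a family growing with \<open>n\<close> expresses a bound on a
  function that increases by a limited amount per jump.\<close>

lemma taboo_mono:
  assumes "x \<in> T 0" "\<And>n z. z \<in> T n \<Longrightarrow> set_pmf (jump_pmf q z) \<subseteq> T (Suc n)"
    and "\<And>z. z \<in> T n \<Longrightarrow> f z \<le> g z"
  shows "taboo q x n f \<le> taboo q x n g"
  using assms(3)
proof (induction n arbitrary: f g)
  case 0
  then show ?case using assms(1) by simp
next
  case (Suc n)
  show ?case
    unfolding taboo.simps
  proof (rule Suc.IH)
    fix z assume "z \<in> T n"
    then show "(\<integral>\<^sup>+y. (if y = x then 0 else f y) \<partial>measure_pmf (jump_pmf q z)) \<le>
      (\<integral>\<^sup>+y. (if y = x then 0 else g y) \<partial>measure_pmf (jump_pmf q z))"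
      using assms(2) Suc.prems by (intro nn_integral_mono_AE) (auto simp: AE_measure_pmf_iff)
  qed
qed

lemma taboo_add: "taboo q x n (\<lambda>z. f z + g z) = taboo q x n f + taboo q x n g"
proof (induction n arbitrary: f g)
  case (Suc n)
  have "(\<lambda>z. \<integral>\<^sup>+y. (if y = x then 0 else f y + g y) \<partial>measure_pmf (jump_pmf q z)) =
    (\<lambda>z. (\<integral>\<^sup>+y. (if y = x then 0 else f y) \<partial>measure_pmf (jump_pmf q z)) +
      (\<integral>\<^sup>+y. (if y = x then 0 else g y) \<partial>measure_pmf (jump_pmf q z)))"
    by (subst nn_integral_add[symmetric]) (auto intro!: nn_integral_cong)
  then show ?case by (simp add: Suc.IH)
qed simp

lemma taboo_cmult: "taboo q x n (\<lambda>z. c * f z) = c * taboo q x n f"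
proof (induction n arbitrary: f)
  case (Suc n)
  have "(\<lambda>z. \<integral>\<^sup>+y. (if y = x then 0 else c * f y) \<partial>measure_pmf (jump_pmf q z)) =
    (\<lambda>z. c * (\<integral>\<^sup>+y. (if y = x then 0 else f y) \<partial>measure_pmf (jump_pmf q z)))"
    by (subst nn_integral_cmult[symmetric]) (auto intro!: nn_integral_cong)
  then show ?case by (simp add: Suc.IH)
qed simp

lemma taboo_sum: "finite A \<Longrightarrow> taboo q x n (\<lambda>z. \<Sum>a\<in>A. f a z) = (\<Sum>a\<in>A. taboo q x n (f a))"
proof (induction A rule: finite_induct)
  case empty
  show ?case using taboo_cmult[of q x n 0 "\<lambda>_. 0"] by simp
qed (simp add: taboo_add)

text \<open>The series in \<open>fin\<close> is the mean number of jumps up to the return. Its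
  finiteness is used twice: it forces a return almost surely, as \<open>return_time_le\<close>
  requires, and it bounds the mean return time because every mean holding time is at most
  \<open>1 / e\<close>.\<close>

lemma nn_integral_return_time_finite:
  assumes "x \<in> S" "\<And>z. z \<in> S \<Longrightarrow> set_pmf (jump_pmf q z) \<subseteq> S"
    and "e > 0" "\<And>z. z \<in> S \<Longrightarrow> exit_rate q z \<ge> e"
    and fin: "(\<Sum>n. taboo q x n (\<lambda>_. 1)) < \<infinity>"
  shows "(\<integral>\<^sup>+\<omega>. return_time x \<omega> \<partial>path_measure q x) < \<infinity>"
proof -
  have "(\<integral>\<^sup>+\<omega>. (\<Sum>n. indicator (unreturned x n) \<omega> * 1) \<partial>path_measure q x) = (\<Sum>n. taboo q x n (\<lambda>_. 1))"
    using nn_integral_taboo[where g = "\<lambda>_. 1" and x = x and q = q]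
    by (subst nn_integral_suminf) (auto simp: prob_space.emeasure_space_1[OF prob_space_holding])
  with fin have "AE \<omega> in path_measure q x. (\<Sum>n. indicator (unreturned x n) \<omega> :: ennreal) \<noteq> \<infinity>"
    by (intro nn_integral_PInf_AE) (auto simp: top.not_eq_extremum)
  then have AE: "AE \<omega> in path_measure q x. \<exists>m. \<omega> \<notin> unreturned x m"
  proof eventually_elim
    case (elim \<omega>)
    show ?case
    proof (rule ccontr)
      assume "\<nexists>m. \<omega> \<notin> unreturned x m"
      then have le: "of_nat n \<le> (\<Sum>n. indicator (unreturned x n) \<omega> :: ennreal)" for n
        using sum_le_suminf[of "\<lambda>n. indicator (unreturned x n) \<omega> :: ennreal" "{..<n}"] by simp
      obtain n where "(\<Sum>n. indicator (unreturned x n) \<omega> :: ennreal) < of_nat n"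
        using elim ennreal_Ex_less_of_nat[of "\<Sum>n. indicator (unreturned x n) \<omega>"]
        by (auto simp: top.not_eq_extremum)
      with le[of n] show False by simp
    qed
  qed
  have "(\<integral>\<^sup>+\<omega>. return_time x \<omega> \<partial>path_measure q x) \<le>
     (\<integral>\<^sup>+\<omega>. (\<Sum>n. indicator (unreturned x n) \<omega> * snd (\<omega> n)) \<partial>path_measure q x)"
    using AE AE_holding_time_pos by (intro nn_integral_mono_AE, eventually_elim) (auto intro: return_time_le)
  also have "\<dots> = (\<Sum>n. taboo q x n (\<lambda>y. \<integral>\<^sup>+s. s \<partial>holding_measure q y))"
    by (rule nn_integral_unreturned_time)
  also have "\<dots> \<le> (\<Sum>n. taboo q x n (\<lambda>y. ennreal (1 / e) * 1))"
  proof (intro suminf_le)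
    show "taboo q x n (\<lambda>y. \<integral>\<^sup>+s. s \<partial>holding_measure q y) \<le> taboo q x n (\<lambda>y. ennreal (1 / e) * 1)" for n
    proof (rule taboo_mono[where T = "\<lambda>_. S"])
      fix z assume "z \<in> S"
      then have "exit_rate q z \<ge> e" by fact
      with \<open>e > 0\<close> show "(\<integral>\<^sup>+s. s \<partial>holding_measure q z) \<le> ennreal (1 / e) * 1"
        by (subst nn_integral_holding_measure) (auto intro!: ennreal_leI divide_left_mono)
    qed (use assms in auto)
  qed auto
  also have "\<dots> = ennreal (1 / e) * (\<Sum>n. taboo q x n (\<lambda>y. 1))"
    unfolding taboo_cmult by (rule ennreal_suminf_cmult)
  also have "\<dots> < \<infinity>"
    using fin by (simp add: ennreal_mult_less_top)
  finally show ?thesis .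
qed

text \<open>Every mean holding time is at least \<open>1 / c\<close>, and
  \<open>return_time_ge\<close> holds on each path, so paths that never return are included.\<close>

lemma nn_integral_return_time_infinite:
  assumes "x \<in> S" "\<And>z. z \<in> S \<Longrightarrow> set_pmf (jump_pmf q z) \<subseteq> S"
    and "\<And>z. z \<in> S \<Longrightarrow> exit_rate q z > 0" "\<And>z. z \<in> S \<Longrightarrow> exit_rate q z \<le> c"
    and inf: "(\<Sum>n. taboo q x n (\<lambda>_. 1)) = \<infinity>"
  shows "(\<integral>\<^sup>+\<omega>. return_time x \<omega> \<partial>path_measure q x) = \<infinity>"
proof -
  have c: "c > 0" using assms(3,4)[OF assms(1)] by simp
  have "\<infinity> = ennreal (1 / c) * (\<Sum>n. taboo q x n (\<lambda>y. 1))"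
    using c inf by (simp add: ennreal_mult_top)
  also have "\<dots> = (\<Sum>n. taboo q x n (\<lambda>y. ennreal (1 / c) * 1))"
    unfolding taboo_cmult by (rule ennreal_suminf_cmult[symmetric])
  also have "\<dots> \<le> (\<Sum>n. taboo q x n (\<lambda>y. \<integral>\<^sup>+s. s \<partial>holding_measure q y))"
  proof (intro suminf_le)
    show "taboo q x n (\<lambda>y. ennreal (1 / c) * 1) \<le> taboo q x n (\<lambda>y. \<integral>\<^sup>+s. s \<partial>holding_measure q y)" for n
    proof (rule taboo_mono[where T = "\<lambda>_. S"])
      fix z assume "z \<in> S"
      with assms(3,4) c show "ennreal (1 / c) * 1 \<le> (\<integral>\<^sup>+s. s \<partial>holding_measure q z)"
        by (subst nn_integral_holding_measure) (auto intro!: ennreal_leI divide_left_mono)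
    qed (use assms in auto)
  qed auto
  also have "\<dots> \<le> (\<integral>\<^sup>+\<omega>. return_time x \<omega> \<partial>path_measure q x)"
    unfolding nn_integral_unreturned_time[symmetric] by (intro nn_integral_mono return_time_ge)
  finally show ?thesis by (simp add: top_unique)
qed

section \<open>Drift criteria\<close>

text \<open>Mass balance: in each step the unreturned mass splits into the part that survives and
  the part that jumps to \<open>x\<close>. The \<open>n\<close>-th term is the probability that the
  first return happens at jump \<open>n + 1\<close>, and the partial sums telescope against the
  surviving mass.\<close>

lemma taboo_return_le: "(\<Sum>n. taboo q x n (\<lambda>z. ennreal (pmf (jump_pmf q z) x))) \<le> 1"
proof -
  have K: "(\<integral>\<^sup>+y. (if y = x then 0 else 1) \<partial>measure_pmf p) + ennreal (pmf p x) = 1" for p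
  proof -
    have "ennreal (pmf p x) = (\<integral>\<^sup>+y. indicator {x} y \<partial>measure_pmf p)"
      by (simp add: emeasure_pmf_single)
    then have "(\<integral>\<^sup>+y. (if y = x then 0 else 1) \<partial>measure_pmf p) + ennreal (pmf p x) =
       (\<integral>\<^sup>+y. (if y = x then 0 else 1) + indicator {x} y \<partial>measure_pmf p)"
      by (simp add: nn_integral_add del: nn_integral_indicator)
    also have "\<dots> = (\<integral>\<^sup>+y. 1 \<partial>measure_pmf p)"
      by (intro nn_integral_cong) auto
    finally show ?thesis by simp
  qed
  have "taboo q x M (\<lambda>_. 1) + (\<Sum>n<M. taboo q x n (\<lambda>z. ennreal (pmf (jump_pmf q z) x))) = 1" for M
  proof (induction M)
    case (Suc M)
    have "taboo q x (Suc M) (\<lambda>_. 1) + taboo q x M (\<lambda>z. ennreal (pmf (jump_pmf q z) x)) = taboo q x M (\<lambda>_. 1)"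
      by (simp add: taboo_add[symmetric] K)
    with Suc have "taboo q x (Suc M) (\<lambda>_. 1) + taboo q x M (\<lambda>z. ennreal (pmf (jump_pmf q z) x)) +
       (\<Sum>n<M. taboo q x n (\<lambda>z. ennreal (pmf (jump_pmf q z) x))) = 1"
      by (simp del: taboo.simps)
    then show ?case by (simp add: ac_simps del: taboo.simps)
  qed simp
  then have "(\<Sum>n<M. taboo q x n (\<lambda>z. ennreal (pmf (jump_pmf q z) x))) \<le> 1" for M
    by (metis le_iff_add add.commute)
  then show ?thesis
    unfolding suminf_eq_SUP by (rule SUP_least)
qed

text \<open>Backward induction along a path from \<open>y\<close> to \<open>x\<close>: each visit to a state on the path moves on to
  the next one with a fixed positive probability, and the return to \<open>x\<close> happens at most once.\<close>

lemma taboo_visits_finite: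
  assumes "(y, x) \<in> {(a, b). b \<in> set_pmf (jump_pmf q a)}\<^sup>*"
  shows "(\<Sum>n. taboo q x n (indicator {y})) < \<infinity>"
  using assms
proof (induction rule: converse_rtrancl_induct)
  case base
  have "taboo q x (Suc n) (indicator {x}) = 0" for n
  proof -
    have "(\<integral>\<^sup>+y. (if y = x then 0 else indicator {x} y) \<partial>measure_pmf p) = 0" for p
      by (simp add: nn_integral_0_iff_AE AE_measure_pmf_iff)
    then show ?thesis using taboo_cmult[of q x n 0 "\<lambda>_. 0"] by simp
  qed
  then have "taboo q x n (indicator {x}) = 0" if "n \<noteq> 0" for n
    using that by (cases n) auto
  then have "(\<Sum>n. taboo q x n (indicator {x})) = (\<Sum>n\<in>{0}. taboo q x n (indicator {x}))"
    by (intro suminf_finite) auto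
  then show ?case by simp
next
  case (step y z)
  have p: "pmf (jump_pmf q y) z > 0"
    using step by (simp add: pmf_positive)
  have fin: "(\<Sum>n. taboo q x n (\<lambda>w. ennreal (pmf (jump_pmf q w) z))) < \<infinity>"
  \<comment> \<open>A jump to \<open>x\<close> is removed by the taboo, so the induction hypothesis
    does not count it; in this case the first-return probabilities, of sum at most 1, take its
    place.\<close>
  proof (cases "z = x")
    case True
    with taboo_return_le[of q x] show ?thesis by (auto intro: order.strict_trans1)
  next
    case False
    have "taboo q x (Suc n) (indicator {z}) = taboo q x n (\<lambda>w. ennreal (pmf (jump_pmf q w) z))" for n
    proof -
      have "(\<integral>\<^sup>+y. (if y = x then 0 else indicator {z} y) \<partial>measure_pmf p) = (\<integral>\<^sup>+y. indicator {z} y \<partial>measure_pmf p)" for p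
        using False by (intro nn_integral_cong) auto
      then show ?thesis by (simp add: emeasure_pmf_single)
    qed
    then have "(\<Sum>n. taboo q x n (\<lambda>w. ennreal (pmf (jump_pmf q w) z))) = (\<Sum>n. taboo q x (Suc n) (indicator {z}))"
      by simp
    also have "\<dots> \<le> (\<Sum>n. taboo q x n (indicator {z}))"
    proof -
      have "(\<Sum>n. taboo q x n (indicator {z})) = taboo q x 0 (indicator {z}) + (\<Sum>n. taboo q x (Suc n) (indicator {z}))"
        using suminf_offset[of "\<lambda>n. taboo q x n (indicator {z})" 1] by simp
      then show ?thesis by simp
    qed
    finally show ?thesis using step.IH by (rule order.strict_trans1)
  qed
  have "ennreal (pmf (jump_pmf q y) z) * (\<Sum>n. taboo q x n (indicator {y})) =
    (\<Sum>n. taboo q x n (\<lambda>w. ennreal (pmf (jump_pmf q y) z) * indicator {y} w))"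
    unfolding taboo_cmult by (rule ennreal_suminf_cmult[symmetric])
  also have "\<dots> \<le> (\<Sum>n. taboo q x n (\<lambda>w. ennreal (pmf (jump_pmf q w) z)))"
    by (intro suminf_le taboo_mono[where T = "\<lambda>_. UNIV"]) (auto simp: indicator_def)
  also note fin
  finally show ?case using p by (auto simp: ennreal_mult_less_top)
qed

text \<open>Foster's criterion, written additively because subtraction in \<open>ennreal\<close>
  truncates. Summed over surviving paths, the drift inequality bounds \<open>d\<close> times the
  mean number of jumps by \<open>V x\<close> plus \<open>b\<close> times the mean number of visits
  to \<open>F\<close>. The latter is finite since every state of the finite set \<open>F\<close>
  leads to \<open>x\<close>. Discarding \<open>V x\<close> at the return only helps.\<close>

lemma taboo_sum_finite_if_drift:
  assumes x: "x \<in> S" and S: "\<And>z. z \<in> S \<Longrightarrow> set_pmf (jump_pmf q z) \<subseteq> S"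
    and V: "V x < \<infinity>" and d: "d > 0" and F: "finite F"
    and ret: "\<And>y. y \<in> F \<Longrightarrow> (y, x) \<in> {(a, b). b \<in> set_pmf (jump_pmf q a)}\<^sup>*"
    and drift: "\<And>z. z \<in> S \<Longrightarrow>
      (\<integral>\<^sup>+y. V y \<partial>measure_pmf (jump_pmf q z)) + ennreal d \<le> V z + ennreal b * indicator F z"
  shows "(\<Sum>n. taboo q x n (\<lambda>_. 1)) < \<infinity>"
proof -
  have ind: "taboo q x n (indicator F) = (\<Sum>y\<in>F. taboo q x n (indicator {y}))" for n
  proof -
    have "(indicator F :: _ \<Rightarrow> ennreal) = (\<lambda>z. \<Sum>y\<in>F. indicator {y} z)"
      using F by (auto simp: fun_eq_iff indicator_def sum.If_cases)
    then show ?thesis by (simp only: taboo_sum[OF F])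
  qed
  have main: "taboo q x M V + ennreal d * (\<Sum>n<M. taboo q x n (\<lambda>_. 1)) \<le>
    V x + ennreal b * (\<Sum>n<M. taboo q x n (indicator F))" for M
  proof (induction M)
    case (Suc M)
    have "taboo q x (Suc M) V + ennreal d * taboo q x M (\<lambda>_. 1) =
      taboo q x M (\<lambda>z. (\<integral>\<^sup>+y. (if y = x then 0 else V y) \<partial>measure_pmf (jump_pmf q z)) + ennreal d * 1)"
      by (simp only: taboo_add taboo_cmult taboo.simps)
    also have "\<dots> \<le> taboo q x M (\<lambda>z. V z + ennreal b * indicator F z)"
    proof (rule taboo_mono[where T = "\<lambda>_. S"])
      fix z assume "z \<in> S"
      have "(\<integral>\<^sup>+y. (if y = x then 0 else V y) \<partial>measure_pmf (jump_pmf q z)) \<le> (\<integral>\<^sup>+y. V y \<partial>measure_pmf (jump_pmf q z))"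
        by (intro nn_integral_mono) auto
      then show "(\<integral>\<^sup>+y. (if y = x then 0 else V y) \<partial>measure_pmf (jump_pmf q z)) + ennreal d * 1 \<le>
         V z + ennreal b * indicator F z"
        using drift[OF \<open>z \<in> S\<close>] by (auto intro: add_right_mono order.trans)
    qed (use x S in auto)
    also have "\<dots> = taboo q x M V + ennreal b * taboo q x M (indicator F)"
      by (simp only: taboo_add taboo_cmult)
    finally have step: "taboo q x (Suc M) V + ennreal d * taboo q x M (\<lambda>_. 1) \<le>
      taboo q x M V + ennreal b * taboo q x M (indicator F)" .
    have "taboo q x (Suc M) V + ennreal d * (\<Sum>n<Suc M. taboo q x n (\<lambda>_. 1)) =
      (taboo q x (Suc M) V + ennreal d * taboo q x M (\<lambda>_. 1)) + ennreal d * (\<Sum>n<M. taboo q x n (\<lambda>_. 1))"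
      by (simp add: distrib_left ac_simps del: taboo.simps)
    also have "\<dots> \<le> (taboo q x M V + ennreal b * taboo q x M (indicator F)) + ennreal d * (\<Sum>n<M. taboo q x n (\<lambda>_. 1))"
      using step by (rule add_right_mono)
    also have "\<dots> = (taboo q x M V + ennreal d * (\<Sum>n<M. taboo q x n (\<lambda>_. 1))) + ennreal b * taboo q x M (indicator F)"
      by (simp add: ac_simps)
    also have "\<dots> \<le> (V x + ennreal b * (\<Sum>n<M. taboo q x n (indicator F))) + ennreal b * taboo q x M (indicator F)"
      using Suc by (rule add_right_mono)
    also have "\<dots> = V x + ennreal b * (\<Sum>n<Suc M. taboo q x n (indicator F))"
      by (simp add: distrib_left ac_simps)
    finally show ?case .
  qed simp
  let ?B = "V x + ennreal b * (\<Sum>n. taboo q x n (indicator F))"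
  have B: "?B < \<infinity>"
  proof -
    have "(\<Sum>n. taboo q x n (indicator F)) = (\<Sum>y\<in>F. \<Sum>n. taboo q x n (indicator {y}))"
      unfolding ind by (rule suminf_sum) simp
    also have "\<dots> < \<infinity>"
      using taboo_visits_finite[OF ret] F by (subst infinity_ennreal_def, subst ennreal_sum_less_top) auto
    finally show ?thesis using V by (simp add: ennreal_mult_less_top)
  qed
  have "ennreal d * (\<Sum>n. taboo q x n (\<lambda>_. 1)) = (\<Sum>n. ennreal d * taboo q x n (\<lambda>_. 1))"
    by (rule ennreal_suminf_cmult[symmetric])
  also have "\<dots> \<le> ?B"
    unfolding suminf_eq_SUP[of "\<lambda>n. ennreal d * taboo q x n (\<lambda>_. 1)"]
  proof (rule SUP_least)
    fix M
    have "(\<Sum>n<M. ennreal d * taboo q x n (\<lambda>_. 1)) \<le> taboo q x M V + ennreal d * (\<Sum>n<M. taboo q x n (\<lambda>_. 1))"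
      by (simp add: sum_distrib_left)
    also note main[of M]
    also have "V x + ennreal b * (\<Sum>n<M. taboo q x n (indicator F)) \<le> ?B"
      by (intro add_left_mono mult_left_mono sum_le_suminf) auto
    finally show "(\<Sum>n<M. ennreal d * taboo q x n (\<lambda>_. 1)) \<le> ?B" .
  qed
  also note B
  finally show ?thesis using d by (auto simp: ennreal_mult_less_top)
qed

text \<open>The mean of \<open>L\<close> before the return stays at least \<open>1\<close>, although \<open>L \<le> c * n\<close> after \<open>n\<close> jumps; so the
  probability of no return within \<open>n\<close> jumps is at least \<open>1 / (c * n)\<close>.\<close>

lemma taboo_sum_infinite_if_drift:
  assumes x: "x \<in> S" and S: "\<And>z. z \<in> S \<Longrightarrow> set_pmf (jump_pmf q z) \<subseteq> S"
    and c: "c > 0" and L0: "L x = 0" and L1: "1 \<le> (\<integral>\<^sup>+y. L y \<partial>measure_pmf (jump_pmf q x))"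
    and bound: "\<And>z y. z \<in> S \<Longrightarrow> y \<in> set_pmf (jump_pmf q z) \<Longrightarrow> L y \<le> L z + ennreal c"
    and drift: "\<And>z. z \<in> S \<Longrightarrow> L z \<le> (\<integral>\<^sup>+y. L y \<partial>measure_pmf (jump_pmf q z))"
  shows "(\<Sum>n. taboo q x n (\<lambda>_. 1)) = \<infinity>"
proof -
  have step: "taboo q x (Suc n) L = taboo q x n (\<lambda>z. \<integral>\<^sup>+y. L y \<partial>measure_pmf (jump_pmf q z))" for n
  proof -
    \<comment> \<open>Because \<open>L\<close> vanishes at \<open>x\<close>, removing the returned
      paths costs nothing, and the taboo mean inherits the submartingale property.\<close>
    have "(\<lambda>y. if y = x then 0 else L y) = L" using L0 by auto
    then show ?thesis by simp
  qed
  have ge1: "1 \<le> taboo q x (Suc n) L" for n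
  proof (induction n)
    case 0
    then show ?case using L1 unfolding step by simp
  next
    case (Suc n)
    have "taboo q x (Suc n) L \<le> taboo q x (Suc (Suc n)) L"
      unfolding step[of "Suc n"] by (rule taboo_mono[where T = "\<lambda>_. S"]) (use x S drift in auto)
    with Suc show ?case by (rule order.trans)
  qed
  have le: "taboo q x n L \<le> ennreal (c * real n) * taboo q x n (\<lambda>_. 1)" for n
  proof -
    have "taboo q x n L \<le> taboo q x n (\<lambda>_. ennreal (c * real n) * 1)"
    proof (rule taboo_mono[where T = "\<lambda>n. {z\<in>S. L z \<le> ennreal (c * real n)}"])
      show "set_pmf (jump_pmf q z) \<subseteq> {z \<in> S. L z \<le> ennreal (c * real (Suc n))}"
        if "z \<in> {z \<in> S. L z \<le> ennreal (c * real n)}" for n z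
      proof safe
        fix y assume y: "y \<in> set_pmf (jump_pmf q z)"
        then show "y \<in> S" using that S by auto
        have "L y \<le> ennreal (c * real n) + ennreal c"
          using that bound[of z y] y by (auto intro: order.trans add_right_mono)
        also have "\<dots> = ennreal (c * real (Suc n))"
          using c by (simp add: ennreal_plus[symmetric] algebra_simps del: ennreal_plus)
        finally show "L y \<le> ennreal (c * real (Suc n))" .
      qed
    qed (use x L0 in auto)
    then show ?thesis by (simp only: taboo_cmult)
  qed
  have low: "ennreal (1 / c * inverse (real (Suc n))) \<le> taboo q x (Suc n) (\<lambda>_. 1)" for n
  proof -
    have "ennreal (1 / c * inverse (real (Suc n))) * 1 \<le>
       ennreal (1 / c * inverse (real (Suc n))) * (ennreal (c * real (Suc n)) * taboo q x (Suc n) (\<lambda>_. 1))"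
      using ge1[of n] le[of "Suc n"] by (intro mult_left_mono) (auto intro: order.trans simp del: taboo.simps)
    also have "\<dots> = ennreal ((1 / c * inverse (real (Suc n))) * (c * real (Suc n))) * taboo q x (Suc n) (\<lambda>_. 1)"
      using c by (subst ennreal_mult) (simp_all add: mult.assoc)
    also have "(1 / c * inverse (real (Suc n))) * (c * real (Suc n)) = 1"
      using c by (simp add: field_simps del: of_nat_Suc)
    finally show ?thesis by simp
  qed
  have "(\<Sum>n. ennreal (1 / c * inverse (real (Suc n)))) = \<infinity>"
  proof (rule ccontr)
    assume "(\<Sum>n. ennreal (1 / c * inverse (real (Suc n)))) \<noteq> \<infinity>"
    then have "summable (\<lambda>n. 1 / c * inverse (real (Suc n)))"
      using c by (intro summable_suminf_not_top) auto
    then have "summable (\<lambda>n. inverse (real (Suc n)))"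
      using c summable_mult_D[of "1 / c"] by fastforce
    then have "summable (\<lambda>n. inverse (real n))"
      by (subst (asm) summable_Suc_iff)
    then show False using not_summable_harmonic[where 'a = real] by simp
  qed
  moreover have "(\<Sum>n. ennreal (1 / c * inverse (real (Suc n)))) \<le> (\<Sum>n. taboo q x (Suc n) (\<lambda>_. 1))"
    using low by (intro suminf_le) auto
  ultimately have "(\<Sum>n. taboo q x (Suc n) (\<lambda>_. 1)) = \<infinity>"
    by (simp add: top_unique del: taboo.simps)
  then show ?thesis
    using suminf_offset[of "\<lambda>n. taboo q x n (\<lambda>_. 1)" 1] by simp
qed

section \<open>Reachable states of the network\<close>

text \<open>The invariant of reachable states: nodes hold their own packets, every packet has a
  single source, and labels are contiguous from 1. Contiguity is what makes the next label
  \<open>card (packets x) + 1\<close> fresh.\<close>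

definition well_labelled :: "'v net_state \<Rightarrow> bool" where
  "well_labelled x \<longleftrightarrow> (\<forall>u. x u u = {}) \<and> (\<forall>u u' v v' p. p \<in> x u v \<longrightarrow> p \<in> x u' v' \<longrightarrow> u = u') \<and>
     (\<exists>k. packets x = {1..k})"

definition missing :: "('v::finite) net_state \<Rightarrow> nat" where
  "missing x = (\<Sum>u\<in>UNIV. \<Sum>v\<in>UNIV. card (x u v))"

lemma mem_packets_iff: "p \<in> packets x \<longleftrightarrow> (\<exists>u v. p \<in> x u v)"
  by (auto simp: packets_def originated_def)

lemma subset_packets: "x u v \<subseteq> packets x"
  unfolding packets_def originated_def by blast

lemma well_labelledD:
  assumes "well_labelled x"
  shows "x u u = {}" "p \<in> x u v \<Longrightarrow> p \<in> x u' v' \<Longrightarrow> u = u'" "packets x = {1..card (packets x)}"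
    "finite (x u v)"
proof -
  obtain k where k: "packets x = {1..k}" using assms by (auto simp: well_labelled_def)
  then show "packets x = {1..card (packets x)}" by simp
  with subset_packets[of x u v] show "finite (x u v)" by (auto intro: finite_subset)
qed (use assms in \<open>auto simp: well_labelled_def\<close>)

lemma well_labelled_empty: "well_labelled empty_state"
  by (auto simp: well_labelled_def empty_state_def mem_packets_iff intro!: exI[of _ 0])

lemma missing_empty: "missing empty_state = 0"
  by (simp add: missing_def empty_state_def)

text \<open>A packet with source \<open>u\<close> is available at \<open>u\<close>, by uniqueness of
  sources and \<open>x u u = {}\<close>. So the set to which the discipline gives priority on
  \<open>(u, v)\<close> is the queue \<open>x u v\<close> itself, and the link never idles while
  this queue is nonempty.\<close>

lemma useful_selfish:
  assumes x: "well_labelled x" and uv: "u \<noteq> v"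
  shows "useful x u v \<inter> originated x u = x u v"
proof (intro equalityI subsetI)
  fix p assume "p \<in> useful x u v \<inter> originated x u"
  then obtain w v' where "p \<in> x w v" "p \<in> x u v'"
    by (auto simp: useful_def available_def originated_def)
  with well_labelledD(2)[OF x] show "p \<in> x u v" by metis
next
  fix p assume p: "p \<in> x u v"
  have "p \<notin> x w u" for w
    using well_labelledD(1)[OF x, of u] well_labelledD(2)[OF x p, of w u] by auto
  with p subset_packets[of x u v] show "p \<in> useful x u v \<inter> originated x u"
    by (auto simp: useful_def available_def originated_def)
qed

lemma useful_obtains:
  assumes "p \<in> useful x u v"
  obtains w where "p \<in> x w v"
  using assms by (auto simp: useful_def available_def)

lemma label_bounds:
  assumes "well_labelled x" "p \<in> x u v"
  shows "1 \<le> p" "p \<le> card (packets x)"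
proof -
  have "p \<in> packets x" using assms(2) subset_packets[of x u v] by blast
  then have "p \<in> {1..card (packets x)}" using well_labelledD(3)[OF assms(1)] by blast
  then show "1 \<le> p" "p \<le> card (packets x)" by simp_all
qed

lemma fresh_label: "well_labelled x \<Longrightarrow> Suc (card (packets x)) \<notin> x w v"
  using label_bounds(2)[of x "Suc (card (packets x))" w v] by auto

lemma card_arrive:
  assumes x: "well_labelled x"
  shows "card (arrive u x w v) = card (x w v) + (if w = u \<and> v \<noteq> u then 1 else 0)"
  using fresh_label[OF x, of w v] well_labelledD(4)[OF x, of w v] by (auto simp: arrive_def)

lemma packets_arrive:
  fixes x :: "('v::finite) net_state"
  assumes "CARD('v) \<ge> 2"
  shows "packets (arrive u x) = insert (card (packets x) + 1) (packets x)"
proof -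
  \<comment> \<open>The new packet is visible in the state only through a node that lacks it, which
    takes a second node.\<close>
  have "\<exists>v. v \<noteq> u"
  proof (rule ccontr)
    assume "\<nexists>v. v \<noteq> u"
    then have "(UNIV :: 'v set) = {u}" by auto
    then have "CARD('v) = 1" by (metis card_1_singleton_iff One_nat_def)
    with assms show False by simp
  qed
  then show ?thesis
    by (auto simp: set_eq_iff mem_packets_iff arrive_def split: if_splits)
qed

lemma well_labelled_arrive:
  fixes x :: "('v::finite) net_state"
  assumes c: "CARD('v) \<ge> 2" and x: "well_labelled x"
  shows "well_labelled (arrive u x)"
proof -
  let ?k = "card (packets x)"
  note new = fresh_label[OF x]
  have "packets (arrive u x) = {1..Suc ?k}"
    unfolding packets_arrive[OF c] by (subst (2) well_labelledD(3)[OF x]) (simp add: atLeastAtMostSuc_conv)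
  moreover have "w = w'" if "p \<in> arrive u x w v" "p \<in> arrive u x w' v'" for p w w' v v'
    using that new[of w v] new[of w' v'] well_labelledD(2)[OF x, of p w v w' v']
    by (auto simp: arrive_def split: if_splits)
  moreover have "arrive u x w w = {}" for w
    using well_labelledD(1)[OF x, of w] by (simp add: arrive_def)
  ultimately show ?thesis
    unfolding well_labelled_def by blast
qed

section \<open>Deliveries and relabelling\<close>

lemma relabel_apply: "relabel p x u v = (\<lambda>i. if i > p then i - 1 else i) ` x u v"
  by (simp add: relabel_def)

text \<open>Label \<open>p\<close> is excluded because \<open>p\<close> and \<open>p + 1\<close>
  share the image \<open>p\<close>; once \<open>p\<close> has left, the shift loses nothing.\<close>

lemma inj_relabel: "inj_on (\<lambda>i::nat. if i > p then i - 1 else i) (- {p})"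
  by (auto simp: inj_on_def)

lemma relabel_image:
  fixes p k :: nat
  assumes "p \<in> {1..k}"
  shows "(\<lambda>i. if i > p then i - 1 else i) ` ({1..k} - {p}) = {1..k - 1}"
proof (intro equalityI subsetI)
  fix j assume j: "j \<in> {1..k - 1}"
  show "j \<in> (\<lambda>i. if i > p then i - 1 else i) ` ({1..k} - {p})"
  proof (cases "j < p")
    case True
    with j show ?thesis using assms by (intro image_eqI[of _ _ j]) auto
  next
    case False
    with j show ?thesis by (intro image_eqI[of _ _ "Suc j"]) auto
  qed
qed (use assms in auto)

text \<open>By uniqueness of sources, \<open>p\<close> lies in column \<open>v\<close> only in the
  row of its source \<open>w\<close>, so the removal shrinks exactly one set. Relabelling takes
  place only when no set contains \<open>p\<close>; it is then injective and keeps all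
  cardinalities. The natural subtraction does not truncate, as \<open>p\<close> is in
  \<open>x w v\<close>.\<close>

lemma
  assumes x: "well_labelled x" and p: "p \<in> x w v"
  shows card_deliver: "card (deliver p v x u' v') = card (x u' v') - (if u' = w \<and> v' = v then 1 else 0)"
    and well_labelled_deliver: "well_labelled (deliver p v x)"
proof -
  define y where "y = (\<lambda>u w. if w = v then x u w - {p} else x u w)"
  have d: "deliver p v x = (if p \<in> packets y then y else relabel p y)"
    by (simp add: deliver_def y_def)
  have yx: "y u' v' \<subseteq> x u' v'" for u' v' by (auto simp: y_def)
  have cy: "card (y u' v') = card (x u' v') - (if u' = w \<and> v' = v then 1 else 0)" for u' v'
  proof -
    have "p \<notin> x u' v'" if "u' \<noteq> w"
      using well_labelledD(2)[OF x, of p w v u' v'] p that by auto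
    then show ?thesis using p well_labelledD(4)[OF x] by (auto simp: y_def)
  qed
  have rel: "card (relabel p y u' v') = card (y u' v')" if "p \<notin> packets y" for u' v'
  proof -
    have "y u' v' \<subseteq> - {p}" using that by (auto simp: mem_packets_iff)
    then show ?thesis unfolding relabel_apply
      by (intro card_image inj_on_subset[OF inj_relabel])
  qed
  show "card (deliver p v x u' v') = card (x u' v') - (if u' = w \<and> v' = v then 1 else 0)"
    unfolding d by (auto simp: cy rel)
  obtain k where k: "packets x = {1..k}" using well_labelledD(3)[OF x] by blast
  have pk: "p \<in> {1..k}" using p k by (auto simp: mem_packets_iff)
  have y0: "y u u = {}" "p' \<in> y u v' \<Longrightarrow> p' \<in> y u' v'' \<Longrightarrow> u = u'" for u u' v' v'' p'
    using well_labelledD(1)[OF x, of u] yx[of u u] well_labelledD(2)[OF x, of p' u v' u' v''] yx[of u v'] yx[of u' v''] by auto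
  have py: "packets x - {p} \<subseteq> packets y" "packets y \<subseteq> packets x"
    by (auto simp: mem_packets_iff y_def split: if_splits) metis+
  show "well_labelled (deliver p v x)"
  proof (cases "p \<in> packets y")
    case True
    with py have "packets y = {1..k}" unfolding k[symmetric] by auto
    with True y0 show ?thesis unfolding d well_labelled_def by auto
  next
    case False
    let ?r = "\<lambda>i. if i > p then i - 1 else i"
    have "packets (relabel p y) = ?r ` packets y"
      unfolding packets_def originated_def relabel_apply image_UN by simp
    also have "packets y = {1..k} - {p}"
      using py False k by auto
    also have "?r ` \<dots> = {1..k - 1}" by (rule relabel_image[OF pk])
    finally have P: "packets (relabel p y) = {1..k - 1}" .
    have "u = u'" if "p' \<in> relabel p y u v'" "p' \<in> relabel p y u' v''" for u u' v' v'' p'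
    proof -
      obtain i j where ij: "i \<in> y u v'" "j \<in> y u' v''" "p' = ?r i" "p' = ?r j"
        using \<open>p' \<in> relabel p y u v'\<close> \<open>p' \<in> relabel p y u' v''\<close> unfolding relabel_apply by blast
      moreover have "i \<noteq> p" "j \<noteq> p" using False ij by (auto simp: mem_packets_iff)
      ultimately have "i = j" using inj_relabel[of p] by (auto simp: inj_on_def)
      with ij y0(2) show ?thesis by blast
    qed
    then show ?thesis
      unfolding d well_labelled_def using False P y0(1) by (auto simp: relabel_apply)
  qed
qed

lemma card_le_missing: "card (x u v) \<le> missing x"
proof -
  have "card (x u v) \<le> (\<Sum>v\<in>UNIV. card (x u v))" by (rule member_le_sum) auto
  also have "\<dots> \<le> missing x"
    unfolding missing_def by (rule member_le_sum[where f = "\<lambda>u. \<Sum>v\<in>UNIV. card (x u v)"]) auto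
  finally show ?thesis .
qed

lemma card_packets_le_missing: "card (packets x) \<le> missing x"
proof -
  have "card (packets x) \<le> (\<Sum>u\<in>UNIV. card (originated x u))"
    unfolding packets_def by (rule card_UN_le) simp
  also have "\<dots> \<le> missing x"
    unfolding missing_def originated_def by (intro sum_mono card_UN_le) simp
  finally show ?thesis .
qed

text \<open>Labels do not exceed the number of packets, and each present packet is missing
  somewhere, so every \<open>x u v\<close> is a subset of \<open>{1..B}\<close>.\<close>

lemma finite_missing_le: "finite {x :: ('v::finite) net_state. well_labelled x \<and> missing x \<le> B}"
proof (rule finite_subset)
  show "{x :: 'v net_state. well_labelled x \<and> missing x \<le> B} \<subseteq>
    (\<Pi>\<^sub>E u\<in>UNIV. \<Pi>\<^sub>E v\<in>UNIV. Pow {1..B})"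
  proof
    fix x :: "'v net_state" assume "x \<in> {x. well_labelled x \<and> missing x \<le> B}"
    then have x: "well_labelled x" "missing x \<le> B" by simp_all
    have "x u v \<subseteq> {1..B}" for u v
    proof
      fix p assume "p \<in> x u v"
      from label_bounds[OF x(1) this] card_packets_le_missing[of x] x(2) show "p \<in> {1..B}" by simp
    qed
    then show "x \<in> (\<Pi>\<^sub>E u\<in>UNIV. \<Pi>\<^sub>E v\<in>UNIV. Pow {1..B})" by auto
  qed
qed (auto intro!: finite_PiE)

lemma missing_arrive:
  fixes x :: "('v::finite) net_state"
  assumes x: "well_labelled x"
  shows "missing (arrive u x) = missing x + card {v. v \<noteq> u}"
proof -
  have "(\<Sum>w\<in>UNIV. \<Sum>v\<in>UNIV. if w = u \<and> v \<noteq> u then 1 else 0 :: nat) =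
    (\<Sum>w\<in>UNIV. if w = u then card {v. v \<noteq> u} else 0)"
    by (intro sum.cong) (auto simp: sum.If_cases)
  then show ?thesis
    unfolding missing_def by (simp add: card_arrive[OF x] sum.distrib)
qed

lemma missing_deliver:
  fixes x :: "('v::finite) net_state"
  assumes x: "well_labelled x" and p: "p \<in> x w v"
  shows "missing x = Suc (missing (deliver p v x))"
proof -
  have pos: "card (x w v) > 0" using p well_labelledD(4)[OF x] by (auto simp: card_gt_0_iff)
  have "card (x u' v') = card (deliver p v x u' v') + (if u' = w \<and> v' = v then 1 else 0)" for u' v'
    using pos unfolding card_deliver[OF x p] by auto
  moreover have "(\<Sum>u'\<in>UNIV. \<Sum>v'\<in>UNIV. if u' = w \<and> v' = v then 1 else 0 :: nat) = 1"
  proof -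
    have "(\<Sum>u'\<in>UNIV. \<Sum>v'\<in>UNIV. if u' = w \<and> v' = v then 1 else 0 :: nat) =
      (\<Sum>u'\<in>UNIV. if u' = w then 1 else 0)"
      by (intro sum.cong) auto
    then show ?thesis by simp
  qed
  ultimately show ?thesis
    unfolding missing_def by (simp add: sum.distrib)
qed

section \<open>Jump expectations for finitely many transitions\<close>

text \<open>Fixing a single state with finitely many targets turns \<open>infsum\<close> and
  \<open>embed_pmf\<close> into finite sums. \<open>A\<close> may contain \<open>x\<close> and
  targets of rate 0, which spares finding the exact support.\<close>

locale finite_rates =
  fixes q :: "'a \<Rightarrow> 'a \<Rightarrow> real" and x :: 'a and A :: "'a set"
  assumes q_nonneg: "\<And>y. q x y \<ge> 0" and finA: "finite A" and supp: "\<And>y. y \<notin> A \<Longrightarrow> q x y = 0"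
begin

lemma exit_rate_eq_sum: "exit_rate q x = (\<Sum>y\<in>A - {x}. q x y)"
proof -
  have "exit_rate q x = infsum (q x) (A - {x})"
    unfolding exit_rate_def by (rule infsum_cong_neutral) (auto intro: supp)
  then show ?thesis using finA by simp
qed

lemma le_exit_rate: "y \<noteq> x \<Longrightarrow> q x y \<le> exit_rate q x"
proof (cases "y \<in> A")
  case True
  assume "y \<noteq> x"
  with True finA q_nonneg show ?thesis
    unfolding exit_rate_eq_sum by (intro member_le_sum) auto
next
  case False
  then show ?thesis using q_nonneg by (simp add: supp exit_rate_eq_sum sum_nonneg)
qed

lemma pmf_jump_pmf:
  assumes r: "exit_rate q x > 0"
  shows "pmf (jump_pmf q x) y = (if y = x then 0 else q x y / exit_rate q x)"
proof -
  let ?f = "\<lambda>y. if y = x then 0 else q x y / exit_rate q x"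
  have "(\<integral>\<^sup>+y. ennreal (?f y) \<partial>count_space UNIV) = (\<Sum>y\<in>A - {x}. ennreal (?f y))"
    using finA supp by (intro nn_integral_count_space') auto
  also have "\<dots> = ennreal (\<Sum>y\<in>A - {x}. ?f y)"
    using r q_nonneg by (intro sum_ennreal) auto
  also have "(\<Sum>y\<in>A - {x}. ?f y) = (\<Sum>y\<in>A - {x}. q x y) / exit_rate q x"
    unfolding sum_divide_distrib by (intro sum.cong) auto
  also have "\<dots> = 1"
    using r unfolding exit_rate_eq_sum[symmetric] by simp
  finally have "(\<integral>\<^sup>+y. ennreal (?f y) \<partial>count_space UNIV) = 1" by simp
  then have "pmf (embed_pmf ?f) y = ?f y"
    using r q_nonneg by (intro pmf_embed_pmf) auto
  then show ?thesis using r by (simp add: jump_pmf_def)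
qed

lemma set_pmf_jump_pmf:
  assumes r: "exit_rate q x > 0"
  shows "set_pmf (jump_pmf q x) = {y. y \<noteq> x \<and> q x y > 0}"
  using r q_nonneg by (auto simp: set_pmf_eq pmf_jump_pmf less_le)

text \<open>The mean after a jump is expressed by the generator: drift per unit time divided by the
  exit rate. In this form \<open>y = x\<close> contributes 0, so epochs without effect need no
  separate treatment. Nonnegativity permits splitting the mean inside
  \<open>ennreal\<close>.\<close>

lemma nn_integral_jump_pmf:
  assumes r: "exit_rate q x > 0" and g: "\<And>y. g y \<ge> 0"
  shows "(\<integral>\<^sup>+y. ennreal (g y) \<partial>measure_pmf (jump_pmf q x)) =
      ennreal (g x + (\<Sum>y\<in>A. q x y * (g y - g x)) / exit_rate q x)"
    and "g x + (\<Sum>y\<in>A. q x y * (g y - g x)) / exit_rate q x \<ge> 0"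
proof -
  let ?r = "exit_rate q x"
  have "(\<Sum>y\<in>A. q x y * (g y - g x)) = (\<Sum>y\<in>A - {x}. q x y * (g y - g x))"
    using finA by (intro sum.mono_neutral_right) auto
  also have "\<dots> = (\<Sum>y\<in>A - {x}. q x y * g y) - g x * ?r"
    unfolding exit_rate_eq_sum by (simp add: algebra_simps sum_subtractf sum_distrib_left)
  finally have eq: "g x + (\<Sum>y\<in>A. q x y * (g y - g x)) / ?r = (\<Sum>y\<in>A - {x}. q x y * g y) / ?r"
    using r by (simp add: field_simps)
  have "(\<integral>\<^sup>+y. ennreal (g y) \<partial>measure_pmf (jump_pmf q x)) =
     (\<Sum>y\<in>A - {x}. ennreal (g y) * ennreal (pmf (jump_pmf q x) y))"
    using finA r supp by (intro nn_integral_measure_pmf_support) (auto simp: set_pmf_jump_pmf)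
  also have "\<dots> = (\<Sum>y\<in>A - {x}. ennreal (q x y * g y / ?r))"
    using r g q_nonneg by (intro sum.cong) (auto simp: pmf_jump_pmf ennreal_mult[symmetric] mult.commute)
  also have "\<dots> = ennreal ((\<Sum>y\<in>A - {x}. q x y * g y) / ?r)"
    using r g q_nonneg by (subst sum_ennreal) (auto simp: sum_divide_distrib)
  finally show "(\<integral>\<^sup>+y. ennreal (g y) \<partial>measure_pmf (jump_pmf q x)) =
      ennreal (g x + (\<Sum>y\<in>A. q x y * (g y - g x)) / exit_rate q x)"
    by (simp add: eq)
  show "g x + (\<Sum>y\<in>A. q x y * (g y - g x)) / exit_rate q x \<ge> 0"
    unfolding eq using r g q_nonneg by (auto intro!: divide_nonneg_pos sum_nonneg)
qed

end

lemma sum_pmf_mult_le: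
  fixes g :: "'a \<Rightarrow> real"
  assumes "finite A" "set_pmf p \<subseteq> A" "\<And>y. y \<in> set_pmf p \<Longrightarrow> g y \<le> c"
  shows "(\<Sum>y\<in>A. pmf p y * g y) \<le> c"
proof -
  have "(\<Sum>y\<in>A. pmf p y * g y) \<le> (\<Sum>y\<in>A. pmf p y * c)"
    using assms(3) by (intro sum_mono) (metis mult_left_mono mult_zero_left order_refl pmf_nonneg set_pmf_iff)
  also have "\<dots> = c"
    using sum_pmf_eq_1[OF assms(1,2)] by (simp add: sum_distrib_right[symmetric])
  finally show ?thesis .
qed

lemma sum_pmf_mult_ge:
  fixes g :: "'a \<Rightarrow> real"
  assumes "finite A" "set_pmf p \<subseteq> A" "\<And>y. y \<in> set_pmf p \<Longrightarrow> c \<le> g y"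
  shows "c \<le> (\<Sum>y\<in>A. pmf p y * g y)"
  using sum_pmf_mult_le[OF assms(1,2), of "\<lambda>y. - g y" "- c"] assms(3) by (simp add: sum_negf)

section \<open>Sums over links and the energy\<close>

abbreviation links :: "('v \<times> 'v) set" where
  "links \<equiv> {(u, v). u \<noteq> v}"

lemma sum_links:
  fixes f :: "'v::finite \<Rightarrow> 'v \<Rightarrow> 'b::comm_monoid_add"
  shows "(\<Sum>(u, v)\<in>links. f u v) = (\<Sum>u\<in>UNIV. \<Sum>v\<in>UNIV. if u \<noteq> v then f u v else 0)"
proof -
  have "(\<Sum>u\<in>UNIV. \<Sum>v\<in>UNIV. if u \<noteq> v then f u v else 0) =
    (\<Sum>(u, v)\<in>UNIV. if u \<noteq> v then f u v else 0)"
    by (simp add: sum.cartesian_product)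
  also have "\<dots> = (\<Sum>(u, v)\<in>links. f u v)"
    by (rule sum.mono_neutral_cong_right) auto
  finally show ?thesis by simp
qed

lemma missing_eq_sum_links:
  assumes "well_labelled x"
  shows "missing x = (\<Sum>(u, v)\<in>links. card (x u v))"
  unfolding sum_links missing_def using well_labelledD(1)[OF assms]
  by (intro sum.cong refl) auto

definition energy :: "('v::finite) net_state \<Rightarrow> real" where
  "energy x = (\<Sum>u\<in>UNIV. \<Sum>v\<in>UNIV. real (card (x u v)) ^ 2)"

lemma energy_arrive:
  assumes x: "well_labelled x"
  shows "energy (arrive u x) - energy x = (\<Sum>v\<in>UNIV. if u \<noteq> v then 2 * real (card (x u v)) + 1 else 0)"
proof -
  have "energy (arrive u x) - energy x =
    (\<Sum>w\<in>UNIV. \<Sum>v\<in>UNIV. if w = u then (if u \<noteq> v then 2 * real (card (x u v)) + 1 else 0) else 0)"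
    unfolding energy_def sum_subtractf[symmetric] card_arrive[OF x]
    by (intro sum.cong refl) (auto simp: power2_eq_square algebra_simps)
  also have "\<dots> = (\<Sum>w\<in>UNIV. if w = u then (\<Sum>v\<in>UNIV. if u \<noteq> v then 2 * real (card (x u v)) + 1 else 0) else 0)"
    by (intro sum.cong refl) auto
  finally show ?thesis by simp
qed

lemma energy_deliver:
  assumes x: "well_labelled x" and p: "p \<in> x w v"
  shows "energy (deliver p v x) - energy x = 1 - 2 * real (card (x w v))"
proof -
  have pos: "card (x w v) \<ge> 1" using p well_labelledD(4)[OF x, of w v] by (auto simp: Suc_le_eq card_gt_0_iff)
  have "energy (deliver p v x) - energy x =
    (\<Sum>u'\<in>UNIV. \<Sum>v'\<in>UNIV. if v' = v then (if u' = w then 1 - 2 * real (card (x w v)) else 0) else 0)"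
    unfolding energy_def sum_subtractf[symmetric] card_deliver[OF x p]
    using pos by (intro sum.cong refl) (auto simp: power2_eq_square algebra_simps of_nat_diff)
  then show ?thesis by simp
qed

section \<open>Stability and instability of the network\<close>

locale selfish_network =
  fixes arr :: "'v::finite \<Rightarrow> real" and rule :: "'v fallback_rule"
  assumes card_nodes: "CARD('v) \<ge> 2"
    and arr_nonneg: "\<And>u. arr u \<ge> 0"
    and valid: "valid_fallback_rule arr rule"
begin

abbreviation rate :: "'v net_state \<Rightarrow> 'v net_state \<Rightarrow> real" where
  "rate \<equiv> selfish_rate arr rule"

abbreviation states :: "'v net_state set" where
  "states \<equiv> selfish_states arr rule"

abbreviation transmit :: "'v \<Rightarrow> 'v \<Rightarrow> 'v net_state \<Rightarrow> 'v net_state pmf" where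
  "transmit \<equiv> selfish_transmit rule"

lemma rate_nonneg: "rate x y \<ge> 0"
  unfolding selfish_rate_def by (intro add_nonneg_nonneg sum_nonneg) (auto simp: arr_nonneg)

text \<open>The drift estimates see the fallback rule only through these cases: an epoch without
  effect implies an empty own queue, and otherwise a packet of some queue towards \<open>v\<close>
  is delivered, from \<open>x u v\<close> if it is nonempty. The invariant is a separate assumption
  because its preservation is derived from this lemma.\<close>

lemma set_transmit:
  assumes x: "x \<in> states" "well_labelled x" and uv: "u \<noteq> v" and y: "y \<in> set_pmf (transmit u v x)"
  obtains "y = x" "x u v = {}"
    | p w where "p \<in> x w v" "y = deliver p v x" "x u v \<noteq> {} \<Longrightarrow> w = u"
proof -
  note [simp] = useful_selfish[OF x(2) uv]
  consider "useful x u v = {}" | "x u v \<noteq> {}" "useful x u v \<noteq> {}" | "useful x u v \<noteq> {}" "x u v = {}"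
    by blast
  then show ?thesis
  proof cases
    case 1
    then have "x u v = {}" using useful_selfish[OF x(2) uv] by blast
    with 1 y that(1) show ?thesis by (simp add: selfish_transmit_def)
  next
    case 2
    then have "y = deliver (Min (x u v)) v x"
      using y by (simp add: selfish_transmit_def)
    moreover have "Min (x u v) \<in> x u v"
      using 2 well_labelledD(4)[OF x(2)] by (intro Min_in)
    ultimately show ?thesis using that(2) by blast
  next
    case 3
    then obtain p where p: "p \<in> set_pmf (rule x u v)" "y = deliver p v x"
      using y by (auto simp: selfish_transmit_def)
    have "set_pmf (rule x u v) \<subseteq> useful x u v"
      using valid x(1) uv 3 by (simp add: valid_fallback_rule_def)
    with p(1) have "p \<in> useful x u v" by blast
    then obtain w where "p \<in> x w v" by (rule useful_obtains)
    with 3 p(2) that(2) show ?thesis by blast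
  qed
qed

lemma rate_posE:
  assumes "rate x y > 0"
  obtains u where "y = arrive u x" | u v where "u \<noteq> v" "y \<in> set_pmf (transmit u v x)"
proof (rule ccontr)
  assume "\<not> thesis"
  then have "\<And>u. y \<noteq> arrive u x" "\<And>u v. u \<noteq> v \<Longrightarrow> pmf (transmit u v x) y = 0"
    using that by (auto simp: set_pmf_iff)
  then have "rate x y = 0" unfolding selfish_rate_def by (auto intro!: sum.neutral)
  with assms show False by simp
qed

lemma states_step: "x \<in> states \<Longrightarrow> y \<noteq> x \<Longrightarrow> rate x y > 0 \<Longrightarrow> y \<in> states"
  unfolding selfish_states_def reachable_from_def by (auto intro: rtrancl_into_rtrancl)

lemma empty_in_states: "empty_state \<in> states"
  by (simp add: selfish_states_def reachable_from_def)

lemma well_labelled_states: "x \<in> states \<Longrightarrow> well_labelled x"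
proof -
  assume "x \<in> states"
  then have "(empty_state, x) \<in> {(a, b). a \<noteq> b \<and> rate a b > 0}\<^sup>*"
    by (simp add: selfish_states_def reachable_from_def)
  then show ?thesis
  proof (induction rule: rtrancl_induct)
    case base
    show ?case by (rule well_labelled_empty)
  next
    case (step y z)
    have y: "y \<in> states" using step(1) by (simp add: selfish_states_def reachable_from_def)
    from step(2) have "rate y z > 0" by simp
    then show ?case
    proof (cases rule: rate_posE)
      case (1 u)
      then show ?thesis using well_labelled_arrive[OF card_nodes step.IH] by simp
    next
      case (2 u v)
      show ?thesis
        using set_transmit[OF y step.IH 2] well_labelled_deliver[OF step.IH] step.IH by metis
    qed
  qed
qed

lemma transmit_cases:
  assumes "x \<in> states" "u \<noteq> v" "y \<in> set_pmf (transmit u v x)"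
  shows "y = x \<and> x u v = {} \<or>
    (\<exists>p w. p \<in> x w v \<and> y = deliver p v x \<and> (x u v \<noteq> {} \<longrightarrow> w = u))"
  using set_transmit[OF assms(1) well_labelled_states[OF assms(1)] assms(2,3)] by metis

text \<open>A convenient superset of the targets: it contains \<open>x\<close> if some epoch has no
  effect, and arrivals at nodes of rate 0.\<close>

definition succs :: "'v net_state \<Rightarrow> 'v net_state set" where
  "succs x = range (\<lambda>u. arrive u x) \<union> (\<Union>(u, v)\<in>links. set_pmf (transmit u v x))"

lemma finite_succs:
  assumes x: "x \<in> states"
  shows "finite (succs x)"
proof -
  note wl = well_labelled_states[OF x]
  have "finite (set_pmf (transmit u v x))" if "u \<noteq> v" for u v
  proof (rule finite_subset)
    show "set_pmf (transmit u v x) \<subseteq> insert x (\<Union>w. (\<lambda>p. deliver p v x) ` x w v)"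
      using transmit_cases[OF x that] by blast
    show "finite (insert x (\<Union>w. (\<lambda>p. deliver p v x) ` x w v))"
      using well_labelledD(4)[OF wl] by auto
  qed
  then show ?thesis by (auto simp: succs_def)
qed

lemma finite_rates:
  assumes x: "x \<in> states"
  shows "finite_rates rate x (succs x)"
proof
  fix y
  show "rate x y \<ge> 0" by (rule rate_nonneg)
  show "finite (succs x)" by (rule finite_succs[OF x])
  show "rate x y = 0" if y: "y \<notin> succs x"
  proof (rule ccontr)
    assume "rate x y \<noteq> 0"
    with rate_nonneg[of x y] have "rate x y > 0" by simp
    then show False
      by (cases rule: rate_posE) (use y in \<open>auto simp: succs_def\<close>)
  qed
qed

section \<open>Generator sums and exit rates\<close>

lemmas exit_rate_sum = finite_rates.exit_rate_eq_sum[OF finite_rates]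
  and rate_le_exit_rate = finite_rates.le_exit_rate[OF finite_rates]
  and set_jump_pmf = finite_rates.set_pmf_jump_pmf[OF finite_rates]
  and nn_integral_jump = finite_rates.nn_integral_jump_pmf(1)[OF finite_rates]
  and drift_nonneg = finite_rates.nn_integral_jump_pmf(2)[OF finite_rates]

text \<open>Different events may lead to the same state. Exchanging the sum over target states for a
  sum over events allows a drift to be estimated event by event.\<close>

lemma sum_rate:
  assumes x: "x \<in> states"
  shows "(\<Sum>y\<in>succs x. rate x y * g y) =
    (\<Sum>u\<in>UNIV. arr u * g (arrive u x)) + (\<Sum>(u, v)\<in>links. \<Sum>y\<in>succs x. pmf (transmit u v x) y * g y)"
proof -
  note fin = finite_succs[OF x]
  have "(\<Sum>y\<in>succs x. rate x y * g y) =
    (\<Sum>y\<in>succs x. \<Sum>u\<in>UNIV. (if y = arrive u x then arr u else 0) * g y) +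
    (\<Sum>y\<in>succs x. \<Sum>(u, v)\<in>links. pmf (transmit u v x) y * g y)"
    unfolding selfish_rate_def
    by (simp add: distrib_right sum.distrib sum_distrib_right split_def)
  also have "(\<Sum>y\<in>succs x. \<Sum>u\<in>UNIV. (if y = arrive u x then arr u else 0) * g y) =
    (\<Sum>u\<in>UNIV. \<Sum>y\<in>succs x. if y = arrive u x then arr u * g y else 0)"
    by (subst sum.swap) (intro sum.cong refl, auto)
  also have "\<dots> = (\<Sum>u\<in>UNIV. arr u * g (arrive u x))"
    using fin by (intro sum.cong refl) (simp add: succs_def)
  also have "(\<Sum>y\<in>succs x. \<Sum>(u, v)\<in>links. pmf (transmit u v x) y * g y) =
    (\<Sum>(u, v)\<in>links. \<Sum>y\<in>succs x. pmf (transmit u v x) y * g y)"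
    by (subst sum.swap) (simp add: split_def)
  finally show ?thesis .
qed

lemma set_transmit_succs: "u \<noteq> v \<Longrightarrow> set_pmf (transmit u v x) \<subseteq> succs x"
  by (auto simp: succs_def)

lemma others_nonempty: "card {v. v \<noteq> u} \<ge> 1" for u :: 'v
proof -
  have "{v. v \<noteq> u} = UNIV - {u}" by auto
  then show ?thesis using card_nodes by (simp add: card_Diff_singleton)
qed

lemma arrive_neq: "x \<in> states \<Longrightarrow> arrive u x \<noteq> x"
  using missing_arrive[OF well_labelled_states, of x u] others_nonempty[of u] by auto

text \<open>Each link contributes total mass 1, part of which may stay in \<open>x\<close>; this
  uniform bound converts drift per unit time into drift per jump.\<close>

lemma exit_rate_le:
  assumes x: "x \<in> states"
  shows "exit_rate rate x \<le> (\<Sum>u\<in>UNIV. arr u) + real (card (links :: ('v \<times> 'v) set))"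
proof -
  have "exit_rate rate x \<le> (\<Sum>y\<in>succs x. rate x y * 1)"
    unfolding exit_rate_sum[OF x] using finite_succs[OF x] by (auto intro!: sum_mono2 simp: rate_nonneg)
  also have "\<dots> = (\<Sum>u\<in>UNIV. arr u) + (\<Sum>(u, v)\<in>links. \<Sum>y\<in>succs x. pmf (transmit u v x) y)"
    using sum_rate[OF x, of "\<lambda>_. 1"] by simp
  also have "(\<Sum>(u, v)\<in>links. \<Sum>y\<in>succs x. pmf (transmit u v x) y) = (\<Sum>(u, v)\<in>(links :: ('v \<times> 'v) set). 1)"
    by (intro sum.cong refl) (auto intro!: sum_pmf_eq_1 finite_succs[OF x] dest: set_transmit_succs[of _ _ x])
  finally show ?thesis by (simp add: split_def)
qed

lemma arr_le_rate: "arr u \<le> rate x (arrive u x)"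
proof -
  have "arr u = (if arrive u x = arrive u x then arr u else 0)" by simp
  also have "\<dots> \<le> (\<Sum>u'\<in>UNIV. if arrive u x = arrive u' x then arr u' else 0)"
    by (rule member_le_sum) (auto simp: arr_nonneg)
  also have "\<dots> \<le> rate x (arrive u x)"
    unfolding selfish_rate_def by (auto intro!: sum_nonneg)
  finally show ?thesis .
qed

text \<open>An arrival raises \<open>missing\<close>, hence always changes the state, so it is never
  lost in the excluded diagonal rate.\<close>

lemma arr_le_exit_rate:
  assumes x: "x \<in> states"
  shows "arr u \<le> exit_rate rate x"
  using arr_le_rate[of u x] rate_le_exit_rate[OF x arrive_neq[OF x, of u]] by linarith

section \<open>Irreducibility of the jump chain\<close>

lemma jump_closed: "z \<in> states \<Longrightarrow> set_pmf (jump_pmf rate z) \<subseteq> states"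
proof (cases "exit_rate rate z \<le> 0")
  case True
  assume "z \<in> states"
  with True show ?thesis by (simp add: jump_pmf_def)
next
  case False
  assume "z \<in> states"
  with False show ?thesis using states_step[of z] set_jump_pmf[of z] by auto
qed

lemma rtrancl_jump:
  assumes "(x, y) \<in> {(a, b). a \<noteq> b \<and> rate a b > 0}\<^sup>*" "x \<in> states"
  shows "(x, y) \<in> {(a, b). b \<in> set_pmf (jump_pmf rate a)}\<^sup>*"
proof -
  from assms have "(x, y) \<in> {(a, b). b \<in> set_pmf (jump_pmf rate a)}\<^sup>* \<and> y \<in> states"
  proof (induction rule: rtrancl_induct)
    case base
    then show ?case by simp
  next
    case (step y z)
    then have y: "y \<in> states" and z: "z \<noteq> y" "rate y z > 0" by auto
    then have "exit_rate rate y > 0" using rate_le_exit_rate[OF y z(1)] by linarith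
    with y z have "z \<in> set_pmf (jump_pmf rate y)" by (simp add: set_jump_pmf)
    with step states_step[OF y z] show ?case by (auto intro: rtrancl_into_rtrancl)
  qed
  then show ?thesis ..
qed

text \<open>Any nonempty queue \<open>x u v\<close> is served by its own link, deterministically and
  at rate at least 1, and each delivery lowers \<open>missing\<close>; repeating this empties the
  network.\<close>

lemma empty_reachable:
  assumes "x \<in> states"
  shows "(x, empty_state) \<in> {(a, b). a \<noteq> b \<and> rate a b > 0}\<^sup>*"
  using assms
proof (induction "missing x" arbitrary: x rule: less_induct)
  case less
  note wl = well_labelled_states[OF less.prems]
  show ?case
  proof (cases "x = empty_state")
    case False
    then obtain u v where uv: "x u v \<noteq> {}" by (auto simp: empty_state_def fun_eq_iff)
    with well_labelledD(1)[OF wl] have "u \<noteq> v" by auto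
    let ?p = "Min (x u v)" and ?y = "deliver (Min (x u v)) v x"
    have p: "?p \<in> x u v" using uv well_labelledD(4)[OF wl] by (intro Min_in)
    have sel: "useful x u v \<inter> originated x u = x u v" by (rule useful_selfish[OF wl \<open>u \<noteq> v\<close>])
    then have "transmit u v x = return_pmf ?y"
      using uv by (auto simp: selfish_transmit_def)
    then have "1 = pmf (transmit u v x) ?y" by simp
    also have "\<dots> \<le> (\<Sum>(u, v)\<in>links. pmf (transmit u v x) ?y)"
      using \<open>u \<noteq> v\<close> by (intro member_le_sum[where f = "\<lambda>(u, v). pmf (transmit u v x) ?y" and i = "(u, v)", simplified]) auto
    also have "\<dots> \<le> rate x ?y"
      unfolding selfish_rate_def by (auto intro!: sum_nonneg simp: arr_nonneg)
    finally have r: "rate x ?y > 0" by simp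
    have m: "missing ?y < missing x" using missing_deliver[OF wl p] by simp
    then have ne: "?y \<noteq> x" by auto
    have "(?y, empty_state) \<in> {(a, b). a \<noteq> b \<and> rate a b > 0}\<^sup>*"
      by (rule less.hyps[OF m states_step[OF less.prems ne r]])
    moreover have "(x, ?y) \<in> {(a, b). a \<noteq> b \<and> rate a b > 0}" using r ne by auto
    ultimately show ?thesis by (rule converse_rtrancl_into_rtrancl[rotated])
  qed simp
qed

lemma jump_irreducible:
  assumes "x \<in> states" "y \<in> states"
  shows "(y, x) \<in> {(a, b). b \<in> set_pmf (jump_pmf rate a)}\<^sup>*"
proof -
  have "(empty_state, x) \<in> {(a, b). a \<noteq> b \<and> rate a b > 0}\<^sup>*"
    using assms(1) by (simp add: selfish_states_def reachable_from_def)
  with empty_reachable[OF assms(2)] show ?thesis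
    by (intro rtrancl_jump[OF _ assms(2)]) (rule rtrancl_trans)
qed

text \<open>Without arrivals there is no positive lower bound for the exit rates, so this case is
  settled apart: the only state is absorbing, which counts as positive recurrent.\<close>

lemma states_trivial:
  assumes "\<And>u. arr u = 0"
  shows "states = {empty_state}" "exit_rate rate empty_state = 0"
proof -
  have r: "rate empty_state y = 0" if "y \<noteq> empty_state" for y
  proof -
    have "useful empty_state u v = {}" for u v :: 'v
      by (simp add: useful_def available_def mem_packets_iff empty_state_def)
    then have "transmit u v empty_state = return_pmf empty_state" for u v
      by (simp add: selfish_transmit_def)
    then show ?thesis using that assms by (auto simp: selfish_rate_def intro!: sum.neutral)
  qed
  then show "exit_rate rate empty_state = 0"
    unfolding exit_rate_sum[OF empty_in_states] by (intro sum.neutral) auto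
  have "x = empty_state" if "(empty_state, x) \<in> {(a, b). a \<noteq> b \<and> rate a b > 0}\<^sup>*" for x
    using that by (induction rule: rtrancl_induct) (use r in auto)
  then show "states = {empty_state}"
    using empty_in_states by (auto simp: selfish_states_def reachable_from_def)
qed

section \<open>Stability below capacity\<close>

text \<open>By the priority rule, link \<open>(u, v)\<close> serves \<open>x u v\<close> whenever this set is nonempty; help from other
  nodes only lowers the energy further. So each \<open>card (x u v)\<close> behaves at worst like an M/M/1 queue
  with load \<open>arr u\<close>.\<close>

lemma energy_drift:
  assumes x: "x \<in> states"
  shows "(\<Sum>y\<in>succs x. rate x y * (energy y - energy x)) \<le>
    (\<Sum>(u, v)\<in>links. 2 - 2 * (1 - arr u) * real (card (x u v)) - (1 - arr u))"
proof -
  note wl = well_labelled_states[OF x]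
  have "(\<Sum>y\<in>succs x. rate x y * (energy y - energy x)) =
    (\<Sum>(u, v)\<in>links. arr u * (2 * real (card (x u v)) + 1)) +
    (\<Sum>(u, v)\<in>links. \<Sum>y\<in>succs x. pmf (transmit u v x) y * (energy y - energy x))"
    unfolding sum_rate[OF x] energy_arrive[OF wl] sum_links
    by (simp add: sum_distrib_left if_distrib cong: if_cong)
  also have "\<dots> \<le> (\<Sum>(u, v)\<in>links. arr u * (2 * real (card (x u v)) + 1)) +
    (\<Sum>(u, v)\<in>links. 1 - 2 * real (card (x u v)))"
  proof (intro add_left_mono sum_mono, safe)
    fix u v :: 'v assume uv: "u \<noteq> v"
    show "(\<Sum>y\<in>succs x. pmf (transmit u v x) y * (energy y - energy x)) \<le> 1 - 2 * real (card (x u v))"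
    proof (rule sum_pmf_mult_le[OF finite_succs[OF x] set_transmit_succs[OF uv]])
      fix y assume y: "y \<in> set_pmf (transmit u v x)"
      show "energy y - energy x \<le> 1 - 2 * real (card (x u v))"
        using transmit_cases[OF x uv y]
      proof (elim disjE conjE exE)
        fix p w assume p: "p \<in> x w v" "y = deliver p v x" "x u v \<noteq> {} \<longrightarrow> w = u"
        \<comment> \<open>Help for another queue occurs only when \<open>x u v\<close> is empty;
          then any delivery meets the bound.\<close>
        have "card (x u v) \<le> card (x w v)" using p(3) by (cases "x u v = {}") auto
        with p(2) energy_deliver[OF wl p(1)] show ?thesis by simp
      qed simp
    qed
  qed
  also have "\<dots> = (\<Sum>(u, v)\<in>links. 2 - 2 * (1 - arr u) * real (card (x u v)) - (1 - arr u))"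
    by (simp add: sum.distrib[symmetric] split_def algebra_simps)
  finally show ?thesis .
qed

theorem stable:
  assumes arr1: "\<And>u. arr u < 1"
  shows "selfish_stable arr rule"
  unfolding selfish_stable_def positive_recurrent_on_def
proof
  fix x assume x: "x \<in> states"
  show "positive_recurrent_state rate x"
  proof (cases "\<forall>u. arr u = 0")
    case True
    with states_trivial x show ?thesis by (auto simp: positive_recurrent_state_def)
  next
    case False
    then obtain u0 where u0: "arr u0 > 0" using arr_nonneg by (auto simp: less_le)
    let ?n = "real (card (links :: ('v \<times> 'v) set))"
    define e where "e = arr u0"
    define c where "c = (\<Sum>u\<in>UNIV. arr u) + ?n"
    define m where "m = Min (range (\<lambda>u. 1 - arr u))"
    \<comment> \<open>\<open>B\<close> is the solution of \<open>2 * n - 2 * m * B = - 1\<close>,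
      rounded up, where \<open>n\<close> is the number of links and \<open>m\<close> the smallest
      spare capacity. With more than \<open>B\<close> deliveries missing, the energy drift is at
      most -1 per unit time.\<close>
    define B where "B = nat \<lceil>(2 * ?n + 1) / (2 * m)\<rceil>"
    define F where "F = {z \<in> states. missing z \<le> B}"
    have e: "e > 0" "e \<le> exit_rate rate z" if "z \<in> states" for z
      using u0 arr_le_exit_rate[OF that] by (simp_all add: e_def)
    have c: "exit_rate rate z \<le> c" if "z \<in> states" for z
      using exit_rate_le[OF that] by (simp add: c_def)
    have "c > 0" using e[OF x] c[OF x] by linarith
    have m: "m > 0" "m \<le> 1 - arr u" for u
      using arr1 by (auto simp: m_def)
    have drift: "(\<Sum>y\<in>succs z. rate z y * (energy y - energy z)) \<le> 2 * ?n - 2 * m * real (missing z)"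
      if z: "z \<in> states" for z
    proof -
      have "(\<Sum>y\<in>succs z. rate z y * (energy y - energy z)) \<le>
        (\<Sum>(u, v)\<in>links. 2 - 2 * (1 - arr u) * real (card (z u v)) - (1 - arr u))"
        by (rule energy_drift[OF z])
      also have "\<dots> \<le> (\<Sum>(u, v)\<in>links. 2 - 2 * m * real (card (z u v)))"
      proof (intro sum_mono, safe)
        fix u v
        have "m * real (card (z u v)) \<le> (1 - arr u) * real (card (z u v))"
          using m(2)[of u] by (intro mult_right_mono) auto
        then show "2 - 2 * (1 - arr u) * real (card (z u v)) - (1 - arr u) \<le> 2 - 2 * m * real (card (z u v))"
          using arr1[of u] by linarith
      qed
      also have "\<dots> = 2 * ?n - 2 * m * real (missing z)"
        unfolding missing_eq_sum_links[OF well_labelled_states[OF z]]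
        by (simp add: split_def sum_subtractf sum_distrib_left)
      finally show ?thesis .
    qed
    have "(\<Sum>n. taboo rate x n (\<lambda>_. 1)) < \<infinity>"
    \<comment> \<open>Exit rates lie between \<open>e\<close> and \<open>c\<close>. Outside
      \<open>F\<close> a drift of at most -1 per unit time is at most \<open>- 1 / c\<close> per
      jump, whence \<open>d\<close>. On \<open>F\<close> the drift per jump is at most twice the
      number of links over \<open>e\<close>; the extra \<open>1 / c\<close> in \<open>b\<close> pays
      for \<open>d\<close> there.\<close>
    proof (rule taboo_sum_finite_if_drift[where S = states and V = "\<lambda>z. ennreal (energy z)" and F = F
          and d = "1 / c" and b = "2 * ?n / e + 1 / c"])
      show "finite F"
        unfolding F_def by (rule finite_subset[OF _ finite_missing_le[of B]]) (auto simp: well_labelled_states)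
      show "(y, x) \<in> {(a, b). b \<in> set_pmf (jump_pmf rate a)}\<^sup>*" if "y \<in> F" for y
        using that x by (intro jump_irreducible) (auto simp: F_def)
      fix z assume z: "z \<in> states"
      let ?r = "exit_rate rate z" and ?D = "\<Sum>y\<in>succs z. rate z y * (energy y - energy z)"
      have r: "?r > 0" using e[OF z] by linarith
      have nn: "energy y \<ge> 0" for y :: "'v net_state" by (auto simp: energy_def intro!: sum_nonneg)
      have "energy z + ?D / ?r + 1 / c \<le> energy z + (2 * ?n / e + 1 / c) * indicator F z"
      proof (cases "z \<in> F")
        case True
        have "?D \<le> 2 * ?n" using drift[OF z] m(1) by (simp add: order.trans)
        then have "?D / ?r \<le> 2 * ?n / ?r" using r by (simp add: divide_right_mono)
        also have "\<dots> \<le> 2 * ?n / e" using e[OF z] r by (intro divide_left_mono) auto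
        finally show ?thesis using True by simp
      next
        case False
        with z have "B < missing z" by (simp add: F_def)
        then have "(2 * ?n + 1) / (2 * m) \<le> real (missing z)"
          unfolding B_def by linarith
        then have "?D \<le> - 1" using drift[OF z] m(1) by (simp add: field_simps)
        then have "?D / ?r \<le> - 1 / ?r" using r by (intro divide_right_mono) auto
        also have "\<dots> \<le> - (1 / c)" using c[OF z] r \<open>c > 0\<close> by (simp add: frac_le)
        finally show ?thesis using False by simp
      qed
      then have "ennreal (energy z + ?D / ?r + 1 / c) \<le> ennreal (energy z + (2 * ?n / e + 1 / c) * indicator F z)"
        by (rule ennreal_leI)
      moreover have "ennreal (energy z + ?D / ?r + 1 / c) =
        (\<integral>\<^sup>+y. ennreal (energy y) \<partial>measure_pmf (jump_pmf rate z)) + ennreal (1 / c)"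
        using nn_integral_jump[OF z r, of energy] drift_nonneg[OF z r, of energy] \<open>c > 0\<close> nn z by (simp add: ennreal_plus)
      moreover have "ennreal (energy z + (2 * ?n / e + 1 / c) * indicator F z) =
        ennreal (energy z) + ennreal (2 * ?n / e + 1 / c) * indicator F z"
        using e[OF z] \<open>c > 0\<close> nn by (auto simp: indicator_def ennreal_plus[symmetric] simp del: ennreal_plus)
      ultimately show "(\<integral>\<^sup>+y. ennreal (energy y) \<partial>measure_pmf (jump_pmf rate z)) + ennreal (1 / c) \<le>
        ennreal (energy z) + ennreal (2 * ?n / e + 1 / c) * indicator F z"
        by simp
    qed (use x \<open>c > 0\<close> jump_closed in auto)
    then have "(\<integral>\<^sup>+\<omega>. return_time x \<omega> \<partial>path_measure rate x) < \<infinity>"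
      using x jump_closed e[OF x] e(2) by (intro nn_integral_return_time_finite[where S = states and e = e]) auto
    then show ?thesis by (simp add: positive_recurrent_state_def)
  qed
qed

section \<open>Instability at and above capacity\<close>

theorem unstable:
  assumes arr_ge: "\<And>u. arr u \<ge> 1"
  shows "\<not> selfish_stable arr rule"
proof -
  let ?L = "\<lambda>z. real (missing z)"
  let ?n = "real (card (links :: ('v \<times> 'v) set))"
  define c where "c = (\<Sum>u\<in>UNIV. arr u) + ?n"
  \<comment> \<open>\<open>undefined\<close> stands for an arbitrary node, as all arrival rates are
    at least 1.\<close>
  have r: "exit_rate rate z > 0" "exit_rate rate z \<le> c" if "z \<in> states" for z
    using arr_le_exit_rate[OF that, of undefined] arr_ge[of undefined] exit_rate_le[OF that]
    by (simp_all add: c_def)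
  have deg: "card {w. w \<noteq> u} = CARD('v) - 1" for u :: 'v
  proof -
    have "{w. w \<noteq> u} = UNIV - {u}" by auto
    then show ?thesis by (simp add: card_Diff_singleton)
  qed
  have drift: "(\<Sum>y\<in>succs z. rate z y * (?L y - ?L z)) \<ge> 0" if z: "z \<in> states" for z
  proof -
    note wl = well_labelled_states[OF z]
    \<comment> \<open>The balance is drawn up link by link: \<open>(u, v)\<close> gains a missing
      delivery at rate \<open>arr u\<close>, and its epochs, of rate 1, remove at most one delivery
      each.\<close>
    have "0 \<le> (\<Sum>(u, v)\<in>links. arr u) + (\<Sum>(u, v)\<in>(links :: ('v \<times> 'v) set). - 1)"
      unfolding sum.distrib[symmetric] by (intro sum_nonneg) (auto simp: arr_ge)
    also have "(\<Sum>(u, v)\<in>links. arr u) = (\<Sum>u\<in>UNIV. arr u * (?L (arrive u z) - ?L z))"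
    proof -
      have "(\<Sum>v\<in>UNIV. if u \<noteq> v then arr u else 0) = arr u * (?L (arrive u z) - ?L z)" for u
      proof -
        have "{v. u \<noteq> v} = {v. v \<noteq> u}" by auto
        then show ?thesis unfolding missing_arrive[OF wl] by (simp add: sum.If_cases)
      qed
      then show ?thesis unfolding sum_links by simp
    qed
    also have "(\<Sum>(u, v)\<in>(links :: ('v \<times> 'v) set). - 1) \<le>
      (\<Sum>(u, v)\<in>links. \<Sum>y\<in>succs z. pmf (transmit u v z) y * (?L y - ?L z))"
    proof (intro sum_mono, safe)
      fix u v :: 'v assume uv: "u \<noteq> v"
      show "- 1 \<le> (\<Sum>y\<in>succs z. pmf (transmit u v z) y * (?L y - ?L z))"
      proof (rule sum_pmf_mult_ge[OF finite_succs[OF z] set_transmit_succs[OF uv]])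
        fix y assume y: "y \<in> set_pmf (transmit u v z)"
        show "- 1 \<le> ?L y - ?L z"
          using transmit_cases[OF z uv y]
        proof (elim disjE conjE exE)
          fix p w assume "p \<in> z w v" "y = deliver p v z"
          then show ?thesis using missing_deliver[OF wl, of p w v] by simp
        qed simp
      qed
    qed
    finally show ?thesis unfolding sum_rate[OF z] by simp
  qed
  \<comment> \<open>The largest increase is an arrival, which adds one missing delivery for each
    node but the source; \<open>CARD('v)\<close> is a slightly generous bound.\<close>
  have bound: "?L y \<le> ?L z + real CARD('v)" if z: "z \<in> states" and y: "y \<in> set_pmf (jump_pmf rate z)" for y z
  proof -
    note wl = well_labelled_states[OF z]
    have "rate z y > 0" using y r[OF z] z by (simp add: set_jump_pmf)
    then show ?thesis
    proof (cases rule: rate_posE)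
      case (1 u)
      then show ?thesis using missing_arrive[OF wl, of u] deg[of u] by simp
    next
      case (2 u v)
      show ?thesis
        using transmit_cases[OF z 2]
      proof (elim disjE conjE exE)
        fix p w assume "p \<in> z w v" "y = deliver p v z"
        then show ?thesis using missing_deliver[OF wl, of p w v] by simp
      qed simp
    qed
  qed
  have "(\<Sum>n. taboo rate empty_state n (\<lambda>_. 1)) = \<infinity>"
  proof (rule taboo_sum_infinite_if_drift[where S = states and L = "\<lambda>z. ennreal (?L z)" and c = "real CARD('v)"])
    show "ennreal (?L y) \<le> ennreal (?L z) + ennreal (real CARD('v))"
      if "z \<in> states" "y \<in> set_pmf (jump_pmf rate z)" for y z
      using bound[OF that] by (simp add: ennreal_plus[symmetric] ennreal_leI del: ennreal_plus)
    show "ennreal (?L z) \<le> (\<integral>\<^sup>+y. ennreal (?L y) \<partial>measure_pmf (jump_pmf rate z))" if z: "z \<in> states" for z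
      using nn_integral_jump[OF z r(1)[OF z], of ?L] drift[OF z] r(1)[OF z] z
      by (auto intro!: ennreal_leI)
    show "1 \<le> (\<integral>\<^sup>+y. ennreal (?L y) \<partial>measure_pmf (jump_pmf rate empty_state))"
    proof -
      \<comment> \<open>The empty state is the only reachable one with nothing missing, so every
        jump out of it makes \<open>missing\<close> at least 1. This starts the submartingale
        argument.\<close>
      have "missing y \<ge> 1" if "y \<in> set_pmf (jump_pmf rate empty_state)" for y
      proof (rule ccontr)
        assume "\<not> missing y \<ge> 1"
        then have 0: "missing y = 0" by simp
        have y: "y \<in> states" using that jump_closed[OF empty_in_states] by auto
        have "y u v = {}" for u v
          using card_le_missing[of y u v] 0
            well_labelledD(4)[OF well_labelled_states[OF y], of u v] by simp
        then have "y = empty_state" by (simp add: empty_state_def fun_eq_iff)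
        with that r(1)[OF empty_in_states] show False
          by (simp add: set_jump_pmf empty_in_states)
      qed
      then have "(\<integral>\<^sup>+y. 1 \<partial>measure_pmf (jump_pmf rate empty_state)) \<le>
        (\<integral>\<^sup>+y. ennreal (?L y) \<partial>measure_pmf (jump_pmf rate empty_state))"
        by (intro nn_integral_mono_AE) (auto simp: AE_measure_pmf_iff)
      then show ?thesis by simp
    qed
  qed (use empty_in_states jump_closed in \<open>auto simp: missing_empty\<close>)
  then have "(\<integral>\<^sup>+\<omega>. return_time empty_state \<omega> \<partial>path_measure rate empty_state) = \<infinity>"
    using empty_in_states jump_closed r
    by (intro nn_integral_return_time_infinite[where S = states and c = c]) auto
  then have "\<not> positive_recurrent_state rate empty_state"
    using r(1)[OF empty_in_states] by (simp add: positive_recurrent_state_def)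
  then show ?thesis
    using empty_in_states by (auto simp: selfish_stable_def positive_recurrent_on_def)
qed

end

theorem lemma3p3:
  fixes arr :: "'v::finite \<Rightarrow> real" and rule :: "'v fallback_rule"
  assumes "CARD('v) \<ge> 2"
    and "\<And>u. arr u \<ge> 0"
    and "valid_fallback_rule arr rule"
  shows "((\<forall>u. arr u < 1) \<longrightarrow> selfish_stable arr rule) \<and>
         (\<forall>l. (\<forall>u. arr u = l) \<longrightarrow> (selfish_stable arr rule \<longleftrightarrow> l < 1))"
proof -
  interpret selfish_network arr rule
    using assms by unfold_locales
  have "l < 1" if "selfish_stable arr rule" "\<forall>u. arr u = l" for l
    using that unstable by (cases "l < 1") auto
  with stable show ?thesis by auto
qed

end
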